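(* Let $k\ge 2$ be an integer, let $1<p<\infty$ and $1\le q<\infty$. Let $0<\beta_m\le\alpha_m<1$ for $m=1,\ldots,k$ be such that $$\alpha_{j+1}-\frac{\beta_{j+1}}{2}\le \alpha_j-\frac{\beta_j}{2}\quad\text{for all }1\le j\le k-1,$$ and $$\Big(\alpha_k-\frac{\beta_k}{2}\Big)+(k-1)\Big(\alpha_1-\frac{\beta_1}{2}\Big)<1.$$ Then there exist $k$ non-zero, finite Borel measures $\mu_1,\ldots,\mu_k$ on $\mathbb{R}$, with $\mu_m$ supported on a compact set $E_m\subseteq\mathbb{R}$, satisfying for each $m=1,\ldots,k$ $$|\widehat{d\mu_m}(\xi)|\lesssim |\xi|^{-\beta_m/2}\quad\text{for all }\xi\in\mathbb{R}\setminus\{0\},$$ and such that for every $\varepsilon>0$ there is $0<r_\varepsilon<\frac14$ with $$r^{\alpha_m+\varepsilon}\lesssim \mu_m(B(x,r))\lesssim r^{\alpha_m}\quad\text{for all }0<r<r_\varepsilon,\ x\in E_m,$$ and such that the following holds: if $$q<\frac{2p\big(1-\sum_{m=1}^k\alpha_m\big)+p\sum_{m=1}^k\beta_m}{(p-1)\sum_{m=1}^k\beta_m},$$ then there exist $k$ sequences of functions $\{f_{\ell,m}\}_{\ell\in\mathbb{N}}$, $m=1,\ldots,k$, such that $$\frac{\big\|\prod_{m=1}^k\widehat{f_{\ell,m}\,d\mu_m}\big\|_{L^q(\mathbb{R})}}{\prod_{m=1}^k\|f_{\ell,m}\|_{L^p(d\mu_m)}}\to\infty\quad\text{as }\ell\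to\infty.$$
   Context: For a finite Borel measure $\mu$ on $\mathbb{R}$ and $f\in L^1(\mu)$, $\widehat{f\,d\mu}(\xi)=\int f(x)e^{-2\pi i x\xi}\,d\mu(x)$, and $\widehat{d\mu}$ is the case $f\equiv1$. $B(x,r)$ is the ball of centre $x$ and radius $r$. $A\lesssim B$ means $A\le CB$ for some constant $0<C<\infty$; in the displayed conditions the constant does not depend on $\xi$, $x$ or $r$. In the quotient, $f_{\ell,m}\in L^p(d\mu_m)$ has $0<\|f_{\ell,m}\|_{L^p(d\mu_m)}<\infty$. *)

theory Defs
  imports "HOL-Analysis.Analysis"
begin

definition fourier_measure :: "real measure \<Rightarrow> (real \<Rightarrow> complex) \<Rightarrow> real \<Rightarrow> complex" where
  "fourier_measure M f \<xi> = (LINT x|M. f x * exp (- 2 * of_real pi * \<i> * of_real x * of_real \<xi>))"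

(* There is no powr on ennreal, so the p-th root of an infinite integral is set to top by hand. *)
definition Lp_norm :: "real \<Rightarrow> 'a measure \<Rightarrow> ('a \<Rightarrow> complex) \<Rightarrow> ennreal" where
  "Lp_norm p M f =
     (let I = (\<integral>\<^sup>+ x. ennreal (norm (f x) powr p) \<partial>M)
      in if I = top then top else ennreal (enn2real I powr (1 / p)))"

definition Lp_space :: "real \<Rightarrow> 'a measure \<Rightarrow> ('a \<Rightarrow> complex) set" where
  "Lp_space p M = {f \<in> borel_measurable M. Lp_norm p M f < top}"

definition finite_borel_measure :: "real measure \<Rightarrow> bool" where
  "finite_borel_measure M \<longleftrightarrow> sets M = sets borel \<and> finite_measure M"

definition supported_on :: "real measure \<Rightarrow> real set \<Rightarrow> bool" where
  "supported_on M E \<longleftrightarrow> emeasure M (- E) = 0"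

definition fourier_decay :: "real \<Rightarrow> real measure \<Rightarrow> bool" where
  "fourier_decay \<beta> M \<longleftrightarrow>
     (\<exists>C>0. \<forall>\<xi>. \<xi> \<noteq> 0 \<longrightarrow> norm (fourier_measure M (\<lambda>_. 1) \<xi>) \<le> C * \<bar>\<xi>\<bar> powr (- \<beta> / 2))"

(* The constants may depend on \<epsilon> (the relation is stated for each fixed \<epsilon>), but not on r and x. *)
definition ball_condition :: "real \<Rightarrow> real \<Rightarrow> real \<Rightarrow> real measure \<Rightarrow> real set \<Rightarrow> bool" where
  "ball_condition \<alpha> \<epsilon> r\<^sub>0 M E \<longleftrightarrow>
     (\<exists>C>0. \<exists>C'>0. \<forall>r x. 0 < r \<longrightarrow> r < r\<^sub>0 \<longrightarrow> x \<in> E \<longrightarrow>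
        r powr (\<alpha> + \<epsilon>) \<le> C * measure M (ball x r) \<and>
        measure M (ball x r) \<le> C' * r powr \<alpha>)"

end

theory Submission
  imports Defs
begin

text \<open>
  Each measure lives on a random-like binary Cantor set: at the levels in \<open>Br\<close> both children of
  every interval are kept, at the other levels one child is chosen by a sign. The signs come from a
  Salem--Zygmund argument, so that depth \<open>j\<close> contributes about \<open>2 powr (- \<alpha> * j / 2) * sqrt j\<close> to
  the Fourier transform; keeping slightly too many intervals absorbs the factor \<open>sqrt j\<close> and costs
  only an \<open>\<epsilon>\<close> in the lower ball estimate. A structured subtree, with total mass about
  \<open>2 powr (- \<beta> * j / 2)\<close> at depth \<open>j\<close>, is exempt from the signs and takes left children instead, which
  the decay exponent \<open>\<beta>\<close> can afford. Its free binary digits form the final segments of the blocks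
  \<open>[i\<^sup>2, (i + 1)\<^sup>2)\<close> and have density \<open>\<gamma> = \<alpha> - \<beta> / 2\<close>. Hence there are about
  \<open>2 powr ((1 - \<gamma>) * n)\<close> integer frequencies below \<open>2 ^ n\<close> whose product with every point of the
  subtree at depth \<open>n\<close> is close to an integer. The subtrees of the \<open>k\<close> measures are nested, so they
  share the frequencies of the first one, and the indicator functions of the truncated subtrees make
  the quotient blow up.
\<close>

section \<open>Signs with small exponential sums\<close>

text \<open>The subtree makes the quotient large and also threatens the decay: no cancellation is
  claimed on it, so at depth \<open>j\<close> it enters with its full share
  \<open>2 powr (cnt S j - cnt Br j)\<close> of the mass, which has to be acceptable at every depth.
  Free digits at block ends serve this, since their count never runs ahead of
  \<open>\<gamma> * j\<close>, and they also make the contribution of a block to a subtree point a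
  small integer. Block length \<open>2 * i + 1\<close> is a compromise: the resonance errors of the
  blocks are summable, while rounding each block to whole digits, or stopping inside one, costs only
  \<open>O(sqrt j)\<close> in exponents.

  At depth \<open>n = I\<^sup>2\<close> the subtree of measure \<open>m\<close> has mass about
  \<open>2 powr (- \<beta> m * n / 2)\<close>. Let \<open>\<Gamma>\<close> and \<open>B\<close> be
  the sums of the \<open>\<gamma> m\<close> and the \<open>\<beta> m\<close>. With
  \<open>2 powr ((1 - \<Gamma>) * n)\<close> frequencies the quotient is about 2 to the power
  \<open>n * ((1 - \<Gamma>) / q - (1 - 1 / p) * B / 2)\<close>, and this exponent is positive
  exactly when \<open>q\<close> is below the stated threshold. Taking \<open>\<Gamma>\<close>
  instead of \<open>\<gamma> 1\<close> thins out the frequencies; the gap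
  \<open>\<Gamma> - \<gamma> 1 > 0\<close> is what makes the resonance errors decay
  geometrically.\<close>

lemma sinh_le_mult_cosh:
  fixes x :: real
  assumes "0 \<le> x"
  shows "sinh x \<le> x * cosh x"
proof -
  let ?f = "\<lambda>x::real. x * cosh x - sinh x"
  have "?f 0 \<le> ?f x"
  proof (rule DERIV_nonneg_imp_nondecreasing[OF assms])
    fix t :: real assume t: "0 \<le> t" "t \<le> x"
    have "(?f has_real_derivative t * sinh t) (at t)"
      by (auto intro!: derivative_eq_intros)
    thus "\<exists>y. (?f has_real_derivative y) (at t) \<and> 0 \<le> y"
      using t by (intro exI[of _ "t * sinh t"]) auto
  qed
  thus ?thesis by simp
qed

text \<open>The sub-Gaussian bound for a fair random sign, whose moment generating function is
  \<open>cosh\<close>.\<close>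

lemma cosh_le_exp_half_square:
  fixes x :: real
  shows "cosh x \<le> exp (x\<^sup>2 / 2)"
proof -
  have *: "cosh x \<le> exp (x\<^sup>2 / 2)" if "0 \<le> x" for x :: real
  proof -
    let ?g = "\<lambda>x::real. cosh x * exp (- (x\<^sup>2) / 2)"
    have "?g x \<le> ?g 0"
    proof (rule DERIV_nonpos_imp_nonincreasing[OF that])
      fix t :: real assume t: "0 \<le> t" "t \<le> x"
      have "(?g has_real_derivative (sinh t - t * cosh t) * exp (- (t\<^sup>2) / 2)) (at t)"
        by (auto intro!: derivative_eq_intros simp: algebra_simps)
      moreover have "(sinh t - t * cosh t) * exp (- (t\<^sup>2) / 2) \<le> 0"
        using sinh_le_mult_cosh[OF t(1)] by (intro mult_nonpos_nonneg) auto
      ultimately show "\<exists>y. (?g has_real_derivative y) (at t) \<and> y \<le> 0" by blast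
    qed
    thus ?thesis by (simp add: exp_minus field_simps)
  qed
  from *[of "\<bar>x\<bar>"] show ?thesis by (simp add: cosh_real_abs)
qed

lemma norm_cis_diff_le: "norm (cis a - cis b) \<le> \<bar>a - b\<bar>"
proof -
  have "cis a - cis b = cis b * (cis (a - b) - 1)"
    by (simp add: algebra_simps cis_mult)
  hence "norm (cis a - cis b) = norm (cis (a - b) - 1)"
    by (simp add: norm_mult)
  also have "\<dots> = 2 * \<bar>sin ((a - b) / 2)\<bar>"
    by (simp only: cis_conv_exp dist_exp_i_1)
  also have "\<dots> \<le> \<bar>a - b\<bar>"
    using abs_sin_x_le_abs_x[of "(a - b) / 2"] by simp
  finally show ?thesis .
qed

text \<open>The method of conditional expectations. \<open>P\<close> and \<open>Q\<close> are the
  potentials after giving the new element the sign 1 or -1; their average gains at most the factor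
  \<open>exp (c\<^sup>2 / 2)\<close>, so one of the two choices is good enough.\<close>

lemma signs_potential:
  fixes x :: "'a \<Rightarrow> 't \<Rightarrow> real" and c :: real
  assumes "finite A" "finite T" and "\<And>a t. a \<in> A \<Longrightarrow> t \<in> T \<Longrightarrow> \<bar>x a t\<bar> \<le> 1"
  shows "\<exists>\<sigma>. (\<forall>a. \<sigma> a \<in> {-1, 1::real}) \<and>
    (\<Sum>t\<in>T. cosh (c * (\<Sum>a\<in>A. \<sigma> a * x a t))) \<le> real (card T) * exp (c\<^sup>2 * real (card A) / 2)"
  using assms(1,3)
proof (induction A rule: finite_induct)
  case empty
  show ?case by (intro exI[of _ "\<lambda>_. 1"]) simp
next
  case (insert b A)
  then obtain \<sigma> where \<sigma>: "\<And>a. \<sigma> a \<in> {-1, 1::real}"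
    and le: "(\<Sum>t\<in>T. cosh (c * (\<Sum>a\<in>A. \<sigma> a * x a t))) \<le> real (card T) * exp (c\<^sup>2 * real (card A) / 2)"
    by auto
  define S where "S t = c * (\<Sum>a\<in>A. \<sigma> a * x a t)" for t
  define P where "P = (\<Sum>t\<in>T. cosh (S t + c * x b t))"
  define Q where "Q = (\<Sum>t\<in>T. cosh (S t - c * x b t))"
  have "P + Q = (\<Sum>t\<in>T. 2 * (cosh (S t) * cosh (c * x b t)))"
    unfolding P_def Q_def sum.distrib[symmetric] by (simp add: cosh_add cosh_diff)
  also have "\<dots> \<le> (\<Sum>t\<in>T. 2 * (cosh (S t) * exp (c\<^sup>2 / 2)))"
  proof (intro sum_mono mult_left_mono)
    fix t assume "t \<in> T"
    hence "\<bar>x b t\<bar> \<le> 1" using insert.prems by blast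
    hence "(c * x b t)\<^sup>2 \<le> c\<^sup>2"
      by (metis abs_le_square_iff abs_mult abs_one mult.right_neutral mult_left_mono abs_ge_zero)
    hence "exp ((c * x b t)\<^sup>2 / 2) \<le> exp (c\<^sup>2 / 2)" by simp
    with cosh_le_exp_half_square[of "c * x b t"] show "cosh (c * x b t) \<le> exp (c\<^sup>2 / 2)" by linarith
  qed (auto intro: less_imp_le)
  also have "\<dots> = 2 * exp (c\<^sup>2 / 2) * (\<Sum>t\<in>T. cosh (S t))"
    by (simp add: mult_ac flip: sum_distrib_left sum_distrib_right)
  also have "\<dots> \<le> 2 * exp (c\<^sup>2 / 2) * (real (card T) * exp (c\<^sup>2 * real (card A) / 2))"
    using le by (intro mult_left_mono) (auto simp: S_def)
  also have "\<dots> = 2 * (real (card T) * exp (c\<^sup>2 * real (card (insert b A)) / 2))"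
    using insert.hyps by (simp add: algebra_simps add_divide_distrib exp_add)
  finally have PQ: "P + Q \<le> 2 * (real (card T) * exp (c\<^sup>2 * real (card (insert b A)) / 2))" .
  have ex: "\<exists>e \<in> {-1, 1}. (\<Sum>t\<in>T. cosh (S t + e * (c * x b t))) \<le> real (card T) * exp (c\<^sup>2 * real (card (insert b A)) / 2)"
  proof (cases "P \<le> Q")
    case True
    thus ?thesis using PQ by (intro bexI[of _ 1]) (auto simp: P_def)
  next
    case False
    thus ?thesis using PQ by (intro bexI[of _ "-1"]) (auto simp: Q_def)
  qed
  then obtain e where e: "e \<in> {-1, 1}"
    "(\<Sum>t\<in>T. cosh (S t + e * (c * x b t))) \<le> real (card T) * exp (c\<^sup>2 * real (card (insert b A)) / 2)" ..
  have "c * (\<Sum>a\<in>insert b A. (\<sigma>(b := e)) a * x a t) = S t + e * (c * x b t)" for t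
  proof -
    have "(\<Sum>a\<in>A. (\<sigma>(b := e)) a * x a t) = (\<Sum>a\<in>A. \<sigma> a * x a t)"
      using insert.hyps by (intro sum.cong) auto
    thus ?thesis using insert.hyps by (simp add: S_def algebra_simps)
  qed
  thus ?case using e \<sigma> by (intro exI[of _ "\<sigma>(b := e)"]) auto
qed

lemma signs_bound:
  fixes x :: "'a \<Rightarrow> 't \<Rightarrow> real"
  assumes "finite A" "finite T" "T \<noteq> {}" and "\<And>a t. a \<in> A \<Longrightarrow> t \<in> T \<Longrightarrow> \<bar>x a t\<bar> \<le> 1"
  shows "\<exists>\<sigma>. (\<forall>a. \<sigma> a \<in> {-1, 1::real}) \<and>
    (\<forall>t\<in>T. \<bar>\<Sum>a\<in>A. \<sigma> a * x a t\<bar> \<le> sqrt (2 * ln (2 * real (card T)) * real (card A)))"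
proof (cases "A = {}")
  case True
  thus ?thesis by (intro exI[of _ "\<lambda>_. 1"]) simp
next
  case False
  define L where "L = ln (2 * real (card T))"
  define n where "n = real (card A)"
  have n: "n > 0" using False assms by (simp add: n_def card_gt_0_iff)
  have T: "real (card T) \<ge> 1" using assms by (simp add: Suc_le_eq card_gt_0_iff)
  have L: "L > 0" using T by (simp add: L_def)
  \<comment> \<open>A single term of the potential gives
    \<open>\<bar>sum\<bar> \<le> L / c + c * n / 2\<close>; this \<open>c\<close> minimises the
    right-hand side.\<close>
  define c where "c = sqrt (2 * L / n)"
  have c: "c > 0" "c\<^sup>2 = 2 * L / n" using L n by (auto simp: c_def)
  obtain \<sigma> where \<sigma>: "\<And>a. \<sigma> a \<in> {-1, 1::real}"
    and le: "(\<Sum>t\<in>T. cosh (c * (\<Sum>a\<in>A. \<sigma> a * x a t))) \<le> real (card T) * exp (c\<^sup>2 * n / 2)"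
    using signs_potential[of A T x c] assms(1,2,4) unfolding n_def by blast
  have "\<bar>\<Sum>a\<in>A. \<sigma> a * x a t\<bar> \<le> sqrt (2 * L * n)" if t: "t \<in> T" for t
  proof -
    define u where "u = c * \<bar>\<Sum>a\<in>A. \<sigma> a * x a t\<bar>"
    have "exp u / 2 \<le> cosh u" by (simp add: cosh_field_def)
    also have "\<dots> = cosh (c * (\<Sum>a\<in>A. \<sigma> a * x a t))"
      using c by (metis u_def abs_mult abs_of_pos cosh_real_abs)
    also have "\<dots> \<le> (\<Sum>t\<in>T. cosh (c * (\<Sum>a\<in>A. \<sigma> a * x a t)))"
      using t assms(2) by (intro member_le_sum) (auto intro: less_imp_le)
    also note le
    also have "real (card T) * exp (c\<^sup>2 * n / 2) = real (card T) * exp L"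
      using n c by simp
    also have "\<dots> = exp (2 * L) / 2"
      using T by (simp add: L_def exp_double power2_eq_square)
    finally have "u \<le> 2 * L" by simp
    hence "\<bar>\<Sum>a\<in>A. \<sigma> a * x a t\<bar> \<le> 2 * L / c"
      using c by (simp add: u_def field_simps)
    also have "2 * L / c = sqrt (2 * L * n)"
    proof (rule real_sqrt_unique[symmetric])
      show "(2 * L / c)\<^sup>2 = 2 * L * n"
        unfolding power_divide c(2) using L n by (simp add: field_simps power2_eq_square)
    qed (use L c in auto)
    finally show ?thesis .
  qed
  thus ?thesis using \<sigma> unfolding L_def n_def by blast
qed

text \<open>All \<theta> are controlled through a finite grid. The frequencies are below
  \<open>N = 2 ^ j\<close>, so passing to a grid point at distance at most \<open>1 / N^2\<close>
  changes the sum by at most \<open>2 * pi\<close>, and the logarithm of the grid size is only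
  linear in \<open>j\<close>. The grid point costs \<open>6 * R\<close> and the passage
  \<open>8 * R\<close>, which stays below 16.\<close>

lemma salem_zygmund_signs:
  fixes A :: "nat set" and j :: nat
  assumes "A \<subseteq> {..<2 ^ j}"
  shows "\<exists>\<sigma>. (\<forall>a. \<sigma> a \<in> {-1, 1::real}) \<and>
    (\<forall>\<theta>. norm (\<Sum>a\<in>A. of_real (\<sigma> a) * cis (2 * pi * \<theta> * real a))
            \<le> 16 * sqrt (real (Suc j) * real (card A)))"
proof -
  define N where "N = (2::nat) ^ j"
  have finA: "finite A" using assms finite_subset by blast
  have cardA: "card A \<le> N" using card_mono[OF _ assms] by (simp add: N_def)
  \<comment> \<open>The Boolean selects the cosine or the sine, so that the bound for real vectors
    covers both parts of the exponential.\<close>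
  define T where "T = {..N^2} \<times> (UNIV :: bool set)"
  define x where "x a t = (let \<phi> = 2 * pi * (real (fst t) / real N ^ 2) * real a in if snd t then cos \<phi> else sin \<phi>)"
    for a :: nat and t :: "nat \<times> bool"
  have "finite T" "T \<noteq> {}" by (auto simp: T_def)
  moreover have "\<bar>x a t\<bar> \<le> 1" for a t by (simp add: x_def Let_def)
  ultimately obtain \<sigma> where \<sigma>: "\<And>a. \<sigma> a \<in> {-1, 1::real}"
    and bd: "\<And>t. t \<in> T \<Longrightarrow> \<bar>\<Sum>a\<in>A. \<sigma> a * x a t\<bar> \<le> sqrt (2 * ln (2 * real (card T)) * real (card A))"
    using signs_bound[OF finA, of T x] by blast
  have cT: "card T = 2 * (N^2 + 1)" by (simp add: T_def card_cartesian_product)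
  have "ln (2 * real (card T)) \<le> ln (8 * 4 ^ j)"
  proof -
    have "(1::real) \<le> 4 ^ j" by simp
    moreover have "real N ^ 2 = 4 ^ j" by (simp add: N_def power2_eq_square flip: power_mult_distrib)
    ultimately show ?thesis by (subst ln_le_cancel_iff) (auto simp: cT add_pos_pos)
  qed
  also have "\<dots> = ln 8 + real j * ln 4" by (simp add: ln_mult ln_realpow)
  also have "\<dots> = (3 + 2 * real j) * ln 2"
    using ln_realpow[of 2 3] ln_realpow[of 2 2] by (simp add: algebra_simps)
  also have "\<dots> \<le> (3 + 2 * real j) * 1"
    using ln_2_less_1 by (intro mult_left_mono) auto
  finally have L: "ln (2 * real (card T)) \<le> 4 * real (Suc j)" by simp
  define R where "R = sqrt (real (Suc j) * real (card A))"
  have bd': "\<bar>\<Sum>a\<in>A. \<sigma> a * x a t\<bar> \<le> 3 * R" if "t \<in> T" for t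
  proof -
    have "2 * ln (2 * real (card T)) * real (card A) \<le> 9 * (real (Suc j) * real (card A))"
    proof -
      have "2 * ln (2 * real (card T)) * real (card A) \<le> 8 * (real (Suc j) * real (card A))"
        using mult_right_mono[OF L, of "2 * real (card A)"] by (simp add: mult_ac)
      moreover have "0 \<le> real (Suc j) * real (card A)" by simp
      ultimately show ?thesis by linarith
    qed
    hence "sqrt (2 * ln (2 * real (card T)) * real (card A)) \<le> sqrt (9 * (real (Suc j) * real (card A)))"
      by simp
    thus ?thesis using bd[OF that] by (simp add: R_def real_sqrt_mult)
  qed
  have "norm (\<Sum>a\<in>A. of_real (\<sigma> a) * cis (2 * pi * \<theta> * real a)) \<le> 16 * R" for \<theta>
  proof (cases "A = {}")
    case True
    thus ?thesis by (simp add: R_def)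
  next
    case False
    define \<tau> where "\<tau> = frac \<theta>"
    have \<tau>: "0 \<le> \<tau>" "\<tau> < 1" by (auto simp: \<tau>_def frac_lt_1)
    have cis\<tau>: "cis (2 * pi * \<theta> * real a) = cis (2 * pi * \<tau> * real a)" for a
    proof -
      have "2 * pi * \<theta> * real a = 2 * pi * \<tau> * real a + 2 * pi * of_int (\<lfloor>\<theta>\<rfloor> * int a)"
        by (simp add: \<tau>_def frac_def algebra_simps)
      thus ?thesis by (simp add: cis_mult[symmetric] cis_multiple_2pi)
    qed
    define k where "k = nat \<lfloor>\<tau> * real N ^ 2\<rfloor>"
    define \<theta>' where "\<theta>' = real k / real N ^ 2"
    have N: "real N > 0" by (simp add: N_def)
    have k: "real k \<le> \<tau> * real N ^ 2" "\<tau> * real N ^ 2 < real k + 1"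
      unfolding k_def using \<tau> N by (auto simp: of_nat_nat)
    have "real k \<le> real N ^ 2" using k(1) \<tau> N by (smt (verit) mult_left_le_one_le zero_le_power2)
    hence kN: "k \<le> N^2" by (metis of_nat_le_iff of_nat_power)
    have diff: "\<bar>\<tau> - \<theta>'\<bar> \<le> 1 / real N ^ 2"
    proof -
      have "\<tau> - \<theta>' = (\<tau> * real N ^ 2 - real k) / real N ^ 2"
        using N by (simp add: \<theta>'_def diff_divide_distrib)
      moreover have "\<bar>\<tau> * real N ^ 2 - real k\<bar> \<le> 1" using k by simp
      ultimately show ?thesis using N by (simp add: divide_right_mono)
    qed
    have card1: "1 \<le> real (card A)" using False finA by (simp add: Suc_le_eq card_gt_0_iff)
    have R1: "1 \<le> R"
    proof -
      have "1 * 1 \<le> real (Suc j) * real (card A)" using card1 by (intro mult_mono) auto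
      thus ?thesis by (simp add: R_def)
    qed
    let ?G = "\<lambda>\<theta>. \<Sum>a\<in>A. of_real (\<sigma> a) * cis (2 * pi * \<theta> * real a)"
    have "norm (?G \<tau> - ?G \<theta>') \<le> (\<Sum>a\<in>A. 2 * pi * (1 / real N))"
      unfolding sum_subtractf[symmetric]
    proof (rule sum_norm_le)
      fix a assume "a \<in> A"
      hence a: "real a \<le> real N" using assms by (force simp: N_def)
      have "norm (of_real (\<sigma> a) * cis (2 * pi * \<tau> * real a) - of_real (\<sigma> a) * cis (2 * pi * \<theta>' * real a))
          = norm (cis (2 * pi * \<tau> * real a) - cis (2 * pi * \<theta>' * real a))"
        using \<sigma>[of a] by (auto simp: right_diff_distrib[symmetric] norm_minus_commute)
      also have "\<dots> \<le> \<bar>2 * pi * \<tau> * real a - 2 * pi * \<theta>' * real a\<bar>" by (rule norm_cis_diff_le)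
      also have "\<dots> = 2 * pi * (\<bar>\<tau> - \<theta>'\<bar> * real a)"
      proof -
        have "2 * pi * \<tau> * real a - 2 * pi * \<theta>' * real a = 2 * pi * ((\<tau> - \<theta>') * real a)"
          by (simp add: algebra_simps)
        thus ?thesis by (simp add: abs_mult)
      qed
      also have "\<dots> \<le> 2 * pi * (1 / real N ^ 2 * real N)"
        using diff a by (intro mult_left_mono mult_mono) auto
      finally show "norm (of_real (\<sigma> a) * cis (2 * pi * \<tau> * real a) - of_real (\<sigma> a) * cis (2 * pi * \<theta>' * real a))
          \<le> 2 * pi * (1 / real N)" using N by (simp add: power2_eq_square)
    qed
    also have "\<dots> = 2 * pi * (real (card A) / real N)" by simp
    also have "\<dots> \<le> 2 * pi * 1"
      using cardA N by (intro mult_left_mono) auto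
    also have "\<dots> \<le> 8 * R" using pi_less_4 R1 by linarith
    finally have 1: "norm (?G \<tau> - ?G \<theta>') \<le> 8 * R" .
    have "Re (?G \<theta>') = (\<Sum>a\<in>A. \<sigma> a * x a (k, True))" "Im (?G \<theta>') = (\<Sum>a\<in>A. \<sigma> a * x a (k, False))"
      by (simp_all add: x_def \<theta>'_def)
    moreover have "(k, True) \<in> T" "(k, False) \<in> T" using kN by (auto simp: T_def)
    ultimately have "norm (?G \<theta>') \<le> 6 * R"
      using cmod_le[of "?G \<theta>'"] bd'[of "(k, True)"] bd'[of "(k, False)"] by linarith
    with 1 have "norm (?G \<tau>) \<le> 14 * R"
      using norm_triangle_sub[of "?G \<tau>" "?G \<theta>'"] by linarith
    thus ?thesis using R1 by (simp add: cis\<tau>)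
  qed
  thus ?thesis using \<sigma> unfolding R_def by blast
qed

section \<open>Block patterns and resonant frequencies\<close>

text \<open>The last \<open>b i\<close> levels of the block \<open>[i\<^sup>2, (i + 1)\<^sup>2)\<close>, for every \<open>i\<close> (provided that
  \<open>b i \<le> 2 * i + 1\<close>).\<close>

definition levels :: "(nat \<Rightarrow> nat) \<Rightarrow> nat set" where
  "levels b = {j. (Suc (floor_sqrt j))\<^sup>2 \<le> j + b (floor_sqrt j)}"

definition cnt :: "nat set \<Rightarrow> nat \<Rightarrow> nat" where
  "cnt S j = card (S \<inter> {..<j})"

lemma cnt_0 [simp]: "cnt S 0 = 0"
  by (simp add: cnt_def)

lemma cnt_Suc: "cnt S (Suc j) = cnt S j + (if j \<in> S then 1 else 0)"
  by (simp add: cnt_def lessThan_Suc)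

lemma cnt_mono: "i \<le> j \<Longrightarrow> cnt S i \<le> cnt S j"
  unfolding cnt_def by (intro card_mono) auto

lemma floor_sqrt_block: "r \<le> 2 * i \<Longrightarrow> floor_sqrt (i\<^sup>2 + r) = i"
  by (rule floor_sqrt_unique) (auto simp: power2_eq_square)

lemma block_mem_levels_iff: "r \<le> 2 * i \<Longrightarrow> i\<^sup>2 + r \<in> levels b \<longleftrightarrow> 2 * i + 1 \<le> r + b i"
  unfolding levels_def mem_Collect_eq by (simp only: floor_sqrt_block) (simp add: power2_eq_square mult_2)

lemma floor_sqrt_cases:
  obtains r where "r \<le> 2 * floor_sqrt j" "j = (floor_sqrt j)\<^sup>2 + r"
proof -
  have "(floor_sqrt j)\<^sup>2 \<le> j" "j < (Suc (floor_sqrt j))\<^sup>2"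
    by (simp_all add: Suc_floor_sqrt_power2_gt)
  thus ?thesis using that[of "j - (floor_sqrt j)\<^sup>2"] by (auto simp: power2_eq_square)
qed

lemma levels_mono: "(\<And>i. s i \<le> b i) \<Longrightarrow> levels s \<subseteq> levels b"
  unfolding levels_def using add_left_mono order_trans by blast

text \<open>The truncated subtraction is 0 on the initial segment of the block, where no level
  belongs to the set, and counts one by one after it.\<close>

lemma cnt_levels_block:
  assumes "b i \<le> 2 * i + 1" "r \<le> 2 * i + 1"
  shows "cnt (levels b) (i\<^sup>2 + r) = cnt (levels b) (i\<^sup>2) + (r - (2 * i + 1 - b i))"
  using assms(2)
proof (induction r)
  case (Suc r)
  hence "i\<^sup>2 + r \<in> levels b \<longleftrightarrow> 2 * i + 1 \<le> r + b i" by (intro block_mem_levels_iff) simp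
  thus ?case using Suc assms(1) by (auto simp: cnt_Suc)
qed simp

lemma cnt_levels_square:
  assumes "\<And>i. b i \<le> 2 * i + 1"
  shows "cnt (levels b) (I\<^sup>2) = (\<Sum>i<I. b i)"
proof (induction I)
  case (Suc I)
  have "(Suc I)\<^sup>2 = I\<^sup>2 + (2 * I + 1)" by (simp add: power2_eq_square)
  thus ?case using cnt_levels_block[of b I "2 * I + 1"] assms[of I] Suc by simp
qed simp

lemma sum_affine_odd: "(\<Sum>i<I. c * (2 * real i + 1) + e) = c * (real I)\<^sup>2 + e * real I"
  by (induction I) (auto simp: power2_eq_square algebra_simps)

definition free_len :: "real \<Rightarrow> nat \<Rightarrow> nat" where
  "free_len \<gamma> i = nat \<lfloor>\<gamma> * (2 * real i + 1)\<rfloor>"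

text \<open>The excess 4 per block lifts the count at level \<open>j\<close> above \<open>\<alpha> * j\<close> by a multiple of \<open>sqrt j\<close>, which
  is what absorbs the Salem--Zygmund loss. The minimum is attained by the first argument only
  finitely often.\<close>

definition branch_len :: "real \<Rightarrow> nat \<Rightarrow> nat" where
  "branch_len \<alpha> i = min (2 * i + 1) (free_len \<alpha> i + 4)"

lemma free_len_bounds:
  assumes "0 \<le> \<gamma>"
  shows "real (free_len \<gamma> i) \<le> \<gamma> * (2 * real i + 1)" "\<gamma> * (2 * real i + 1) - 1 \<le> real (free_len \<gamma> i)"
  using assms by (auto simp: free_len_def of_nat_nat)

lemma free_len_mono: "\<gamma> \<le> \<gamma>' \<Longrightarrow> free_len \<gamma> i \<le> free_len \<gamma>' i"
  unfolding free_len_def by (intro nat_mono floor_mono mult_right_mono) auto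

lemma free_len_le:
  assumes "0 \<le> \<gamma>" "\<gamma> \<le> 1"
  shows "free_len \<gamma> i \<le> 2 * i + 1"
proof -
  have "real (free_len \<gamma> i) \<le> 1 * (2 * real i + 1)"
    using free_len_bounds(1)[OF assms(1), of i] mult_right_mono[OF assms(2), of "2 * real i + 1"] by linarith
  hence "real (free_len \<gamma> i) \<le> real (2 * i + 1)" by simp
  thus ?thesis by (simp only: of_nat_le_iff)
qed

lemma branch_len_le: "branch_len \<alpha> i \<le> 2 * i + 1"
  by (simp add: branch_len_def)

lemma free_len_le_branch_len:
  assumes "0 \<le> \<gamma>" "\<gamma> \<le> \<alpha>" "\<alpha> \<le> 1"
  shows "free_len \<gamma> i \<le> branch_len \<alpha> i"
  using free_len_mono[OF assms(2), of i] free_len_le[of \<gamma> i] assms by (simp add: branch_len_def)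

text \<open>Because the free levels sit at the end of each block, their density never exceeds its
  limit value, also in the middle of a block.\<close>

lemma cnt_free_le:
  assumes "0 \<le> \<gamma>" "\<gamma> \<le> 1"
  shows "real (cnt (levels (free_len \<gamma>)) j) \<le> \<gamma> * real j"
proof -
  obtain r where r: "r \<le> 2 * floor_sqrt j" and j: "j = (floor_sqrt j)\<^sup>2 + r"
    by (rule floor_sqrt_cases)
  define i where "i = floor_sqrt j"
  note r = r[folded i_def] and j = j[folded i_def]
  have "real (cnt (levels (free_len \<gamma>)) (i\<^sup>2)) = (\<Sum>l<i. real (free_len \<gamma> l))"
    using cnt_levels_square[of "free_len \<gamma>" i] free_len_le[OF assms] by simp
  also have "\<dots> \<le> (\<Sum>l<i. \<gamma> * (2 * real l + 1))"
    using free_len_bounds[OF assms(1)] by (intro sum_mono) auto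
  also have "\<dots> = \<gamma> * real i ^ 2" using sum_affine_odd[of \<gamma> 0 i] by simp
  finally have 1: "real (cnt (levels (free_len \<gamma>)) (i\<^sup>2)) \<le> \<gamma> * real i ^ 2" .
  have eq: "cnt (levels (free_len \<gamma>)) (i\<^sup>2 + r) = cnt (levels (free_len \<gamma>)) (i\<^sup>2) + (r - (2 * i + 1 - free_len \<gamma> i))"
    using r free_len_le[OF assms] by (intro cnt_levels_block) auto
  have 2: "real (r - (2 * i + 1 - free_len \<gamma> i)) \<le> \<gamma> * real r"
  proof (cases "r \<le> 2 * i + 1 - free_len \<gamma> i")
    case False
    hence "real (r - (2 * i + 1 - free_len \<gamma> i)) = real r - (2 * real i + 1) + real (free_len \<gamma> i)"
      using free_len_le[OF assms, of i] by (simp add: of_nat_diff)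
    also have "\<dots> \<le> real r - (2 * real i + 1) + \<gamma> * (2 * real i + 1)"
      using free_len_bounds[OF assms(1)] by simp
    also have "\<dots> = \<gamma> * real r + (1 - \<gamma>) * (real r - (2 * real i + 1))"
      by (simp add: algebra_simps)
    also have "\<dots> \<le> \<gamma> * real r"
      using assms r by (simp add: mult_nonneg_nonpos)
    finally show ?thesis .
  qed (use assms in simp)
  have "real (cnt (levels (free_len \<gamma>)) j) \<le> \<gamma> * (real i ^ 2 + real r)"
    using 1 2 eq j by (simp add: distrib_left)
  also have "real i ^ 2 + real r = real j" using j by (metis of_nat_add of_nat_power)
  finally show ?thesis .
qed

lemma cnt_free_square_ge:
  assumes "0 \<le> \<gamma>" "\<gamma> \<le> 1"
  shows "\<gamma> * (real I)\<^sup>2 - real I \<le> real (cnt (levels (free_len \<gamma>)) (I\<^sup>2))"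
proof -
  have "\<gamma> * (real I)\<^sup>2 - real I = (\<Sum>l<I. \<gamma> * (2 * real l + 1) - 1)"
    using sum_affine_odd[of \<gamma> "-1" I] by simp
  also have "\<dots> \<le> (\<Sum>l<I. real (free_len \<gamma> l))"
    using free_len_bounds[OF assms(1)] by (intro sum_mono) auto
  also have "\<dots> = real (cnt (levels (free_len \<gamma>)) (I\<^sup>2))"
    using cnt_levels_square[of "free_len \<gamma>" I] free_len_le[OF assms] by simp
  finally show ?thesis .
qed

lemma cnt_branch_square_le:
  assumes "0 \<le> \<alpha>"
  shows "real (cnt (levels (branch_len \<alpha>)) (I\<^sup>2)) \<le> \<alpha> * (real I)\<^sup>2 + 4 * real I"
proof -
  have "real (cnt (levels (branch_len \<alpha>)) (I\<^sup>2)) = (\<Sum>l<I. real (branch_len \<alpha> l))"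
    using cnt_levels_square[of "branch_len \<alpha>" I] branch_len_le by simp
  also have "\<dots> \<le> (\<Sum>l<I. \<alpha> * (2 * real l + 1) + 4)"
  proof (intro sum_mono)
    fix l
    have "real (branch_len \<alpha> l) \<le> real (free_len \<alpha> l) + 4" by (simp add: branch_len_def)
    thus "real (branch_len \<alpha> l) \<le> \<alpha> * (2 * real l + 1) + 4"
      using free_len_bounds(1)[OF assms, of l] by linarith
  qed
  also have "\<dots> = \<alpha> * (real I)\<^sup>2 + 4 * real I"
    by (simp add: sum_affine_odd)
  finally show ?thesis .
qed

text \<open>A block that is not clipped gains 4 and loses at most 1 to rounding. The finitely many
  short blocks are charged to \<open>C\<close>.\<close>

lemma cnt_branch_square_ge:
  assumes "0 \<le> \<alpha>" "\<alpha> < 1"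
  shows "\<exists>C. \<forall>I. \<alpha> * (real I)\<^sup>2 + 3 * real I - C \<le> real (cnt (levels (branch_len \<alpha>)) (I\<^sup>2))"
proof -
  \<comment> \<open>From block \<open>L\<close> on, even a clipped block has length at least
    \<open>\<alpha> * (2 * l + 1) + 4\<close>, so clipping does no harm there.\<close>
  obtain L :: nat where L: "4 / (1 - \<alpha>) \<le> real L" using real_arch_simple by blast
  have le: "\<alpha> * (2 * real l + 1) + 3 - (if l < L then 3 else 0) \<le> real (branch_len \<alpha> l)" for l
  proof -
    have 1: "\<alpha> * (2 * real l + 1) + 3 \<le> real (free_len \<alpha> l + 4)"
      using free_len_bounds(2)[OF assms(1), of l] by simp
    have 2: "\<alpha> * (2 * real l + 1) \<le> 1 * (2 * real l + 1)"
      using assms by (intro mult_right_mono) auto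
    have 3: "\<alpha> * (2 * real l + 1) + 3 \<le> 2 * real l + 1" if "L \<le> l"
    proof -
      have "4 / (1 - \<alpha>) \<le> 2 * real l + 1" using L that by simp
      hence "4 \<le> (1 - \<alpha>) * (2 * real l + 1)" using assms by (simp add: field_simps)
      thus ?thesis by (simp add: algebra_simps)
    qed
    have "real (branch_len \<alpha> l) = 2 * real l + 1 \<or> real (branch_len \<alpha> l) = real (free_len \<alpha> l + 4)"
      by (auto simp: branch_len_def min_def)
    thus ?thesis
    proof
      assume "real (branch_len \<alpha> l) = 2 * real l + 1"
      thus ?thesis using 2 3 by (cases "l < L") (simp_all, linarith?)
    next
      assume "real (branch_len \<alpha> l) = real (free_len \<alpha> l + 4)"
      thus ?thesis using 1 by (cases "l < L") (simp_all, linarith?)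
    qed
  qed
  have "\<alpha> * (real I)\<^sup>2 + 3 * real I - 3 * real L \<le> real (cnt (levels (branch_len \<alpha>)) (I\<^sup>2))" for I
  proof -
    have "(\<Sum>l<I. if l < L then 3 else (0::real)) = 3 * real (min I L)"
      by (induction I) (auto simp: min_def)
    also have "\<dots> \<le> 3 * real L" by simp
    finally have "(\<Sum>l<I. if l < L then 3 else (0::real)) \<le> 3 * real L" .
    hence "\<alpha> * (real I)\<^sup>2 + 3 * real I - 3 * real L \<le>
        (\<Sum>l<I. \<alpha> * (2 * real l + 1) + 3 - (if l < L then 3 else 0))"
      by (simp add: sum_subtractf sum_affine_odd)
    also have "\<dots> \<le> (\<Sum>l<I. real (branch_len \<alpha> l))" by (intro sum_mono le)
    also have "\<dots> = real (cnt (levels (branch_len \<alpha>)) (I\<^sup>2))"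
      using cnt_levels_square[of "branch_len \<alpha>" I] branch_len_le by simp
    finally show ?thesis .
  qed
  thus ?thesis by blast
qed

text \<open>This accounts for the excess 4 in \<open>branch_len\<close>: per block, rounding takes
  1, an incomplete last block takes up to \<open>2 * i\<close>, hence 2, and a surplus of 1, in
  total \<open>floor_sqrt j\<close>, is left for the random part.\<close>

lemma cnt_branch_ge:
  assumes "0 \<le> \<alpha>" "\<alpha> < 1"
  shows "\<exists>C. \<forall>j. \<alpha> * real j + real (floor_sqrt j) - C \<le> real (cnt (levels (branch_len \<alpha>)) j)"
proof -
  obtain C where C: "\<And>I. \<alpha> * (real I)\<^sup>2 + 3 * real I - C \<le> real (cnt (levels (branch_len \<alpha>)) (I\<^sup>2))"
    using cnt_branch_square_ge[OF assms] by blast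
  have "\<alpha> * real j + real (floor_sqrt j) - C \<le> real (cnt (levels (branch_len \<alpha>)) j)" for j
  proof -
    obtain r where r: "r \<le> 2 * floor_sqrt j" and j: "j = (floor_sqrt j)\<^sup>2 + r"
      by (rule floor_sqrt_cases)
    define i where "i = floor_sqrt j"
    note r = r[folded i_def] and j = j[folded i_def]
    have "\<alpha> * real r \<le> 1 * (2 * real i)" using assms r by (intro mult_mono) auto
    moreover have "real j = real i ^ 2 + real r" using j by (metis of_nat_add of_nat_power)
    ultimately have "\<alpha> * real j + real i - C \<le> \<alpha> * (real i)\<^sup>2 + 3 * real i - C"
      by (simp add: distrib_left)
    also note C[of i]
    also have "real (cnt (levels (branch_len \<alpha>)) (i\<^sup>2)) \<le> real (cnt (levels (branch_len \<alpha>)) j)"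
      using j by (intro of_nat_mono cnt_mono) simp
    finally show ?thesis unfolding i_def .
  qed
  thus ?thesis by blast
qed

lemma cnt_branch_le:
  assumes "0 \<le> \<alpha>" "\<alpha> < 1"
  shows "real (cnt (levels (branch_len \<alpha>)) j) \<le> \<alpha> * real j + 6 * real (floor_sqrt j) + 5"
proof -
  obtain r where r: "r \<le> 2 * floor_sqrt j" and j: "j = (floor_sqrt j)\<^sup>2 + r"
    by (rule floor_sqrt_cases)
  define i where "i = floor_sqrt j"
  note r = r[folded i_def] and j = j[folded i_def]
  have "real (cnt (levels (branch_len \<alpha>)) j) \<le> real (cnt (levels (branch_len \<alpha>)) ((Suc i)\<^sup>2))"
    using j r by (intro of_nat_mono cnt_mono) (simp add: power2_eq_square)
  also have "\<dots> \<le> \<alpha> * (real (Suc i))\<^sup>2 + 4 * real (Suc i)" by (rule cnt_branch_square_le[OF assms(1)])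
  also have "\<dots> = \<alpha> * real i ^ 2 + \<alpha> * (2 * real i + 1) + 4 * real i + 4"
    by (simp add: power2_eq_square algebra_simps)
  also have "\<dots> \<le> \<alpha> * real j + 1 * (2 * real i + 1) + 4 * real i + 4"
  proof -
    have "\<alpha> * real i ^ 2 \<le> \<alpha> * real j"
      using assms j by (intro mult_left_mono) (metis le_add1 of_nat_le_iff of_nat_power, simp)
    moreover have "\<alpha> * (2 * real i + 1) \<le> 1 * (2 * real i + 1)"
      using assms by (intro mult_right_mono) auto
    ultimately show ?thesis by linarith
  qed
  finally show ?thesis unfolding i_def by simp
qed

section \<open>Digit patterns and the integer frequencies adapted to them\<close>

text \<open>New digits are appended at the low end, so \<open>y / 2 ^ j\<close> is a binary fraction
  whose digit at level \<open>l\<close> is free for \<open>l\<close> in \<open>S\<close> and 0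
  otherwise. Enlarging \<open>S\<close> therefore enlarges the pattern.\<close>

primrec pattern :: "nat set \<Rightarrow> nat \<Rightarrow> nat set" where
  "pattern S 0 = {0}"
| "pattern S (Suc j) = (\<lambda>y. 2 * y) ` pattern S j \<union> (if j \<in> S then (\<lambda>y. 2 * y + 1) ` pattern S j else {})"

lemma finite_pattern [simp]: "finite (pattern S j)"
  by (induction j) auto

lemma card_pattern: "card (pattern S j) = 2 ^ cnt S j"
proof (induction j)
  case (Suc j)
  have "card (pattern S (Suc j)) = card ((\<lambda>y. 2 * y) ` pattern S j) +
      card (if j \<in> S then (\<lambda>y. 2 * y + 1) ` pattern S j else {})"
  proof -
    have "2 * x \<noteq> Suc (2 * y)" for x y :: nat by presburger
    thus ?thesis unfolding pattern.simps by (intro card_Un_disjoint) auto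
  qed
  also have "card ((\<lambda>y. 2 * y) ` pattern S j) = 2 ^ cnt S j"
    using Suc by (subst card_image) (auto simp: inj_on_def)
  also have "card (if j \<in> S then (\<lambda>y. 2 * y + 1) ` pattern S j else {}) = (if j \<in> S then 2 ^ cnt S j else 0)"
    using Suc by (auto simp: card_image inj_on_def)
  finally show ?case by (simp add: cnt_Suc)
qed simp

lemma pattern_mono: "S \<subseteq> S' \<Longrightarrow> pattern S j \<subseteq> pattern S' j"
  by (induction j) auto

text \<open>The digits of a block start with forced zeros, so the block adds only an integer
  \<open>z\<close> with as many binary digits as there are free levels so far.\<close>

lemma pattern_block:
  assumes "b i \<le> 2 * i + 1" "r \<le> 2 * i + 1" "y \<in> pattern (levels b) (i\<^sup>2 + r)"
  shows "\<exists>y' \<in> pattern (levels b) (i\<^sup>2). \<exists>z < 2 ^ (r - (2 * i + 1 - b i)). y = 2 ^ r * y' + z"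
  using assms(2,3)
proof (induction r arbitrary: y)
  case (Suc r)
  let ?m = "2 * i + 1 - b i"
  have mem: "i\<^sup>2 + r \<in> levels b \<longleftrightarrow> 2 * i + 1 \<le> r + b i"
    using Suc.prems by (intro block_mem_levels_iff) simp
  from Suc.prems(2) obtain x e where x: "x \<in> pattern (levels b) (i\<^sup>2 + r)" and y: "y = 2 * x + e"
    and e: "e = 0 \<or> (e = 1 \<and> i\<^sup>2 + r \<in> levels b)"
  proof -
    have "y \<in> (\<lambda>y. 2 * y) ` pattern (levels b) (i\<^sup>2 + r) \<union>
        (if i\<^sup>2 + r \<in> levels b then (\<lambda>y. 2 * y + 1) ` pattern (levels b) (i\<^sup>2 + r) else {})"
      using Suc.prems(2) by simp
    thus ?thesis using that[of _ 0] that[of _ 1] by (auto split: if_splits)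
  qed
  from Suc.IH[OF _ x] Suc.prems(1) obtain y' z where y': "y' \<in> pattern (levels b) (i\<^sup>2)"
    and z: "z < 2 ^ (r - ?m)" and xe: "x = 2 ^ r * y' + z" by auto
  have "2 * z + e < 2 ^ (Suc r - ?m)"
  proof (cases "2 * i + 1 \<le> r + b i")
    case True
    hence "Suc r - ?m = Suc (r - ?m)" by simp
    thus ?thesis using z e by auto
  next
    case False
    hence "r - ?m = 0" "e = 0" using e mem by auto
    thus ?thesis using z by simp
  qed
  moreover have "y = 2 ^ Suc r * y' + (2 * z + e)" using y xe by simp
  ultimately show ?case using y' by blast
qed auto

text \<open>Block \<open>I\<close> of binary digits of a frequency is free only in its lowest \<open>d I\<close> places; multiplied by a
  pattern point whose free digits have the highest denominators of their blocks, the product stays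
  near an integer.\<close>

primrec freqs :: "nat \<Rightarrow> (nat \<Rightarrow> nat) \<Rightarrow> nat \<Rightarrow> nat set" where
  "freqs i0 d 0 = {0}"
| "freqs i0 d (Suc I) =
    (if I < i0 then freqs i0 d I else (\<lambda>(x, h). x + 2 ^ (I\<^sup>2) * h) ` (freqs i0 d I \<times> {..<2 ^ d I}))"

lemma freqs_small: "I \<le> i0 \<Longrightarrow> freqs i0 d I = {0}"
  by (induction I) auto

lemma freqs_Suc_less:
  assumes "x < 2 ^ (I\<^sup>2)" "h < 2 ^ d"
  shows "x + 2 ^ (I\<^sup>2) * h < (2::nat) ^ (I\<^sup>2 + d)"
proof -
  have "x + 2 ^ (I\<^sup>2) * h < 2 ^ (I\<^sup>2) * (h + 1)" using assms by simp
  also have "\<dots> \<le> 2 ^ (I\<^sup>2) * 2 ^ d" using assms by (intro mult_left_mono) auto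
  finally show ?thesis by (simp add: power_add)
qed

lemma freqs_less:
  assumes "\<And>i. d i \<le> 2 * i + 1"
  shows "x \<in> freqs i0 d I \<Longrightarrow> x < 2 ^ (I\<^sup>2)"
proof (induction I arbitrary: x)
  case (Suc I)
  have sq: "(Suc I)\<^sup>2 = I\<^sup>2 + (2 * I + 1)" by (simp add: power2_eq_square)
  show ?case
  proof (cases "I < i0")
    case True
    hence "x < 2 ^ (I\<^sup>2)" using Suc by simp
    also have "\<dots> \<le> (2::nat) ^ ((Suc I)\<^sup>2)" by (intro power_increasing) (auto simp: sq)
    finally show ?thesis .
  next
    case False
    then obtain x' h where x': "x' \<in> freqs i0 d I" "h < 2 ^ d I" "x = x' + 2 ^ (I\<^sup>2) * h"
      using Suc.prems by auto
    hence "x < 2 ^ (I\<^sup>2 + d I)" using freqs_Suc_less Suc.IH by blast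
    also have "\<dots> \<le> (2::nat) ^ ((Suc I)\<^sup>2)" using assms[of I] by (intro power_increasing) (auto simp: sq)
    finally show ?thesis .
  qed
qed auto

lemma finite_freqs [simp]: "finite (freqs i0 d I)"
  by (induction I) auto

lemma card_freqs:
  assumes "\<And>i. d i \<le> 2 * i + 1"
  shows "card (freqs i0 d I) = 2 ^ (\<Sum>i\<in>{i0..<I}. d i)"
proof (induction I)
  case (Suc I)
  show ?case
  proof (cases "I < i0")
    case False
    have "inj_on (\<lambda>(x, h). x + 2 ^ (I\<^sup>2) * h) (freqs i0 d I \<times> {..<2 ^ d I})"
    proof (rule inj_onI, clarsimp)
      fix x h x' h' assume "x \<in> freqs i0 d I" "x' \<in> freqs i0 d I"
        and eq: "x + 2 ^ (I\<^sup>2) * h = x' + 2 ^ (I\<^sup>2) * h'"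
      hence "x < 2 ^ (I\<^sup>2)" "x' < 2 ^ (I\<^sup>2)" using freqs_less[OF assms] by auto
      thus "x = x' \<and> h = h'" using eq
        by (metis (no_types) mod_mult_self2 mod_less add_left_cancel mult_cancel1 power_not_zero zero_neq_numeral)
    qed
    hence "card (freqs i0 d (Suc I)) = card (freqs i0 d I) * 2 ^ d I"
      using False by (simp add: card_image card_cartesian_product)
    thus ?thesis using False Suc by (simp add: power_add)
  qed (use Suc in simp)
qed simp

text \<open>One more block turns \<open>x\<close> into \<open>x' + N * h\<close> and
  \<open>y\<close> into \<open>K * y' + z\<close>. In the product the term \<open>h * y'\<close> is
  an integer, and two new errors appear. Free digits of point and frequency together number at most
  \<open>(1 - (\<gamma>' - \<gamma>)) * (2 * I + 1)\<close>, fewer than the block has levels, so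
  each error is at most \<open>\<rho> ^ (2 * I + 1)\<close>.\<close>

lemma near_integer:
  fixes \<gamma> \<gamma>' :: real
  assumes \<gamma>: "0 \<le> \<gamma>" "\<gamma> < \<gamma>'" "\<gamma>' \<le> 1"
  defines "\<rho> \<equiv> 2 powr (\<gamma> - \<gamma>')"
  assumes "x \<in> freqs i0 (free_len (1 - \<gamma>')) I" "y \<in> pattern (levels (free_len \<gamma>)) (I\<^sup>2)"
  shows "\<exists>z::nat. \<bar>real x * real y / 2 ^ (I\<^sup>2) - real z\<bar> \<le> (\<Sum>l\<in>{i0..<I}. 2 * \<rho> ^ (2 * l + 1))"
  using assms(5,6)
proof (induction I arbitrary: x y)
  case (Suc I)
  let ?d = "free_len (1 - \<gamma>')" and ?s = "free_len \<gamma>"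
  have s: "?s i \<le> 2 * i + 1" and d: "?d i \<le> 2 * i + 1" for i
    by (rule free_len_le; use \<gamma> in simp)+
  have sq: "(Suc I)\<^sup>2 = I\<^sup>2 + (2 * I + 1)" by (simp add: power2_eq_square)
  show ?case
  proof (cases "I < i0")
    case True
    hence "x = 0" using Suc.prems freqs_small[of "Suc I" i0] by simp
    thus ?thesis using True by (intro exI[of _ 0]) simp
  next
    case False
    from False Suc.prems(1) obtain x' h where x': "x' \<in> freqs i0 ?d I" and h: "h < 2 ^ ?d I"
      and x: "x = x' + 2 ^ (I\<^sup>2) * h" by auto
    from pattern_block[of ?s I "2 * I + 1" y] Suc.prems(2) s[of I]
    obtain y' z where y': "y' \<in> pattern (levels ?s) (I\<^sup>2)" and z: "z < 2 ^ ?s I"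
      and y: "y = 2 ^ (2 * I + 1) * y' + z" unfolding sq by auto
    from Suc.IH[OF x' y'] obtain w :: nat where
      w: "\<bar>real x' * real y' / 2 ^ (I\<^sup>2) - real w\<bar> \<le> (\<Sum>l\<in>{i0..<I}. 2 * \<rho> ^ (2 * l + 1))" by blast
    define N where "N = (2::real) ^ (I\<^sup>2)"
    define K where "K = (2::real) ^ (2 * I + 1)"
    have NK: "N > 0" "K > 0" by (auto simp: N_def K_def)
    have "real x * real y / 2 ^ ((Suc I)\<^sup>2) = (real x' + N * real h) * (K * real y' + real z) / (N * K)"
      unfolding sq power_add x y by (simp add: N_def K_def power_add mult_ac)
    \<comment> \<open>The first summand is left to the induction hypothesis, the third is an
      integer, and the other two are the errors of this block.\<close>
    also have "\<dots> = real x' * real y' / N + real x' * real z / (N * K) + real h * real y' + real h * real z / K"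
      using NK by (simp add: field_simps)
    finally have eq: "real x * real y / 2 ^ ((Suc I)\<^sup>2) - real (w + h * y') =
      (real x' * real y' / 2 ^ (I\<^sup>2) - real w) + real x' * real z / (N * K) + real h * real z / K"
      by (simp add: N_def)
    have "real (?s I) + real (?d I) \<le> \<gamma> * (2 * real I + 1) + (1 - \<gamma>') * (2 * real I + 1)"
      using free_len_bounds(1)[of \<gamma> I] free_len_bounds(1)[of "1 - \<gamma>'" I] \<gamma> by simp
    also have "\<dots> = (\<gamma> - \<gamma>') * real (2 * I + 1) + real (2 * I + 1)" by (simp add: algebra_simps)
    finally have exps: "real (?s I) + real (?d I) - real (2 * I + 1) \<le> (\<gamma> - \<gamma>') * real (2 * I + 1)" by simp
    have "2 ^ ?s I * 2 ^ ?d I / K = 2 powr (real (?s I) + real (?d I) - real (2 * I + 1))"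
      unfolding K_def by (simp only: powr_diff powr_add powr_realpow[symmetric] zero_less_numeral)
    also have "\<dots> \<le> 2 powr ((\<gamma> - \<gamma>') * real (2 * I + 1))"
      using exps by (intro powr_mono) auto
    also have "\<dots> = \<rho> ^ (2 * I + 1)"
      unfolding \<rho>_def by (simp only: powr_powr[symmetric] powr_realpow powr_gt_zero)
    finally have sd: "2 ^ ?s I * 2 ^ ?d I / K \<le> \<rho> ^ (2 * I + 1)" .
    have zle: "real z \<le> 2 ^ ?s I" using z by (metis less_imp_le of_nat_le_iff of_nat_numeral of_nat_power)
    have hle: "real h \<le> 2 ^ ?d I" using h by (metis less_imp_le of_nat_le_iff of_nat_numeral of_nat_power)
    have xle: "real x' \<le> N"
      using freqs_less[OF d x'] unfolding N_def by (metis less_imp_le of_nat_le_iff of_nat_numeral of_nat_power)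
    have "real x' * real z / (N * K) \<le> N * 2 ^ ?s I / (N * K)"
      using xle zle NK by (intro divide_right_mono mult_mono) auto
    also have "\<dots> = 2 ^ ?s I * 1 / K" using NK by simp
    also have "\<dots> \<le> 2 ^ ?s I * 2 ^ ?d I / K"
      using NK by (intro divide_right_mono mult_left_mono) auto
    finally have e1: "real x' * real z / (N * K) \<le> \<rho> ^ (2 * I + 1)" using sd by linarith
    have "real h * real z / K \<le> 2 ^ ?d I * 2 ^ ?s I / K"
      using hle zle NK by (intro divide_right_mono mult_mono) auto
    hence e2: "real h * real z / K \<le> \<rho> ^ (2 * I + 1)" using sd by (simp add: mult.commute)
    have "0 \<le> real x' * real z / (N * K)" "0 \<le> real h * real z / K" using NK by auto
    hence "\<bar>real x * real y / 2 ^ ((Suc I)\<^sup>2) - real (w + h * y')\<bar> \<le>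
        (\<Sum>l\<in>{i0..<I}. 2 * \<rho> ^ (2 * l + 1)) + 2 * \<rho> ^ (2 * I + 1)"
      using w e1 e2 unfolding eq abs_le_iff by linarith
    also have "\<dots> = (\<Sum>l\<in>{i0..<Suc I}. 2 * \<rho> ^ (2 * l + 1))" using False by simp
    finally show ?thesis by blast
  qed
qed (auto intro: exI[of _ 0])

section \<open>Cantor trees\<close>

text \<open>The signs at level \<open>j\<close> depend on which intervals survived until then, so
  they have to be chosen inside the recursion. Subtree positions are removed from the exponential
  sum before choosing, since they always go left.\<close>

lemma exists_signed_tree:
  fixes Br S :: "nat set"
  obtains pos :: "nat \<Rightarrow> nat \<Rightarrow> nat" where
    "\<And>b. pos 0 b = 0"
    "\<And>j b. j \<in> Br \<Longrightarrow> pos (Suc j) b = 2 * pos j (b div 2) + b mod 2"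
    "\<And>j. j \<notin> Br \<Longrightarrow> \<exists>\<sigma>. (\<forall>a. \<sigma> a \<in> {-1, 1::real}) \<and>
       (\<forall>b. pos (Suc j) b = 2 * pos j b + (if pos j b \<in> pattern S j \<or> \<sigma> (pos j b) = -1 then 0 else 1)) \<and>
       (\<forall>\<theta>. norm (\<Sum>a\<in>pos j ` {..<2 ^ cnt Br j} - pattern S j. of_real (\<sigma> a) * cis (2 * pi * \<theta> * real a))
          \<le> 16 * sqrt (real (Suc j) * 2 ^ cnt Br j))"
proof -
  define good where "good j A \<sigma> \<longleftrightarrow> (\<forall>a. \<sigma> a \<in> {-1, 1::real}) \<and>
    (\<forall>\<theta>. norm (\<Sum>a\<in>A. of_real (\<sigma> a) * cis (2 * pi * \<theta> * real a)) \<le> 16 * sqrt (real (Suc j) * real (card A)))"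
    for j and A :: "nat set" and \<sigma>
  define sgn where "sgn j A = (SOME \<sigma>. good j A \<sigma>)" for j A
  have sgn: "good j A (sgn j A)" if "A \<subseteq> {..<2 ^ j}" for j A
  proof -
    have "\<exists>\<sigma>. good j A \<sigma>" unfolding good_def by (rule salem_zygmund_signs[OF that])
    thus ?thesis unfolding sgn_def by (rule someI_ex)
  qed
  define step where "step j P = (if j \<in> Br then (\<lambda>b. 2 * P (b div 2) + b mod 2)
      else (\<lambda>b. 2 * P b + (if P b \<in> pattern S j \<or> sgn j (P ` {..<2 ^ cnt Br j} - pattern S j) (P b) = -1 then 0 else 1)))"
    for j :: nat and P :: "nat \<Rightarrow> nat"
  define pos where "pos = rec_nat (\<lambda>_. 0) step"
  have pos_0: "pos 0 b = 0" for b by (simp add: pos_def)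
  have pos_Suc: "pos (Suc j) = step j (pos j)" for j by (simp add: pos_def)
  have less: "pos j b < 2 ^ j" for j b
  proof (induction j arbitrary: b)
    case (Suc j)
    from Suc[of b] Suc[of "b div 2"] show ?case by (auto simp: pos_Suc step_def)
  qed (simp add: pos_0)
  show ?thesis
  proof (rule that[of pos, OF pos_0])
    fix j b assume "j \<in> Br"
    thus "pos (Suc j) b = 2 * pos j (b div 2) + b mod 2" by (simp add: pos_Suc step_def)
  next
    fix j assume j: "j \<notin> Br"
    define A where "A = pos j ` {..<2 ^ cnt Br j} - pattern S j"
    have sub: "A \<subseteq> {..<2 ^ j}" using less by (auto simp: A_def)
    note g = sgn[OF this, unfolded good_def]
    have "card A \<le> card {..<(2::nat) ^ cnt Br j}"
      unfolding A_def by (rule order_trans[OF card_mono card_image_le]) auto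
    hence c: "real (card A) \<le> 2 ^ cnt Br j" by (simp flip: of_nat_le_iff)
    have "norm (\<Sum>a\<in>A. of_real (sgn j A a) * cis (2 * pi * \<theta> * real a)) \<le> 16 * sqrt (real (Suc j) * 2 ^ cnt Br j)" for \<theta>
    proof -
      have "sqrt (real (Suc j) * real (card A)) \<le> sqrt (real (Suc j) * 2 ^ cnt Br j)"
        using c by (intro real_sqrt_le_mono mult_left_mono) auto
      thus ?thesis using g by (meson mult_left_mono order_trans zero_le_numeral)
    qed
    moreover have "pos (Suc j) b = 2 * pos j b + (if pos j b \<in> pattern S j \<or> sgn j A (pos j b) = -1 then 0 else 1)" for b
      using j unfolding pos_Suc step_def A_def by simp
    ultimately show "\<exists>\<sigma>. (\<forall>a. \<sigma> a \<in> {-1, 1::real}) \<and>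
       (\<forall>b. pos (Suc j) b = 2 * pos j b + (if pos j b \<in> pattern S j \<or> \<sigma> (pos j b) = -1 then 0 else 1)) \<and>
       (\<forall>\<theta>. norm (\<Sum>a\<in>pos j ` {..<2 ^ cnt Br j} - pattern S j. of_real (\<sigma> a) * cis (2 * pi * \<theta> * real a))
          \<le> 16 * sqrt (real (Suc j) * 2 ^ cnt Br j))"
      using g unfolding A_def[symmetric] by (intro exI[of _ "sgn j A"]) blast
  qed
qed

text \<open>The average of \<open>exp\<close> over the segment from 0 to \<open>z\<close>: for \<open>z = w / 2 ^ j\<close> it is the transform of the
  uniform distribution on \<open>[0, 1 / 2 ^ j]\<close>.\<close>

definition exp_avg :: "complex \<Rightarrow> complex" where
  "exp_avg z = (if z = 0 then 1 else (exp z - 1) / z)"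

text \<open>The uniform distribution on an interval is the average of those on its two
  halves.\<close>

lemma exp_avg_double: "exp_avg (2 * z) = exp_avg z * ((1 + exp z) / 2)"
proof (cases "z = 0")
  case False
  have "exp (2 * z) - 1 = (exp z - 1) * (1 + exp z)"
    by (simp only: exp_double) (simp add: power2_eq_square algebra_simps)
  thus ?thesis using False by (simp add: exp_avg_def)
qed (simp add: exp_avg_def)

lemma norm_exp_diff_1: "Re z = 0 \<Longrightarrow> norm (exp z - 1) \<le> norm z"
  using norm_cis_diff_le[of "Im z" 0] by (simp add: exp_eq_polar norm_complex_def)

lemma norm_exp_avg_le_1: "Re z = 0 \<Longrightarrow> norm (exp_avg z) \<le> 1"
  using norm_exp_diff_1[of z] by (simp add: exp_avg_def norm_divide divide_le_eq)

lemma norm_exp_avg_le: "Re z = 0 \<Longrightarrow> z \<noteq> 0 \<Longrightarrow> norm (exp_avg z) \<le> 2 / norm z"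
  using norm_triangle_ineq4[of "exp z" 1] by (simp add: exp_avg_def norm_divide divide_right_mono)

lemma exp_avg_tendsto_1: "((\<lambda>j. exp_avg (w / 2 ^ j)) \<longlongrightarrow> 1) sequentially"
proof (cases "w = 0")
  case False
  have 0: "((\<lambda>j. w / 2 ^ j) \<longlongrightarrow> 0) sequentially"
    using tendsto_mult_right_zero[OF LIMSEQ_power_zero[of "1 / 2 :: complex"], of w]
    by (simp add: power_one_over)
  have "((\<lambda>h. (exp (0 + h) - exp 0) / h) \<longlongrightarrow> (exp 0 :: complex)) (at 0)"
    using DERIV_exp[of "0::complex"] by (simp add: DERIV_def)
  hence "((\<lambda>h. (exp h - 1) / h) \<longlongrightarrow> (1::complex)) (at 0)" by simp
  moreover have "filterlim (\<lambda>j. w / 2 ^ j) (at 0) sequentially"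
    using 0 False by (simp add: filterlim_at)
  ultimately have "((\<lambda>j. (exp (w / 2 ^ j) - 1) / (w / 2 ^ j)) \<longlongrightarrow> 1) sequentially"
    by (rule filterlim_compose)
  thus ?thesis using False by (simp add: exp_avg_def)
qed (simp add: exp_avg_def)

lemma sum_div_mod_2:
  fixes f :: "nat \<Rightarrow> nat \<Rightarrow> 'a::comm_monoid_add"
  shows "(\<Sum>b<2 * n. f (b div 2) (b mod 2)) = (\<Sum>b<n. f b 0 + f b 1)"
proof (induction n)
  case (Suc n)
  have "(\<Sum>b<2 * Suc n. f (b div 2) (b mod 2)) = (\<Sum>b<2 * n. f (b div 2) (b mod 2)) + f n 0 + f n 1"
    by (simp add: lessThan_Suc add_ac)
  thus ?case using Suc by (simp add: add_ac)
qed simp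

text \<open>This adds up the contributions of all depths at frequency size \<open>X\<close>. The
  terms grow with ratio \<open>q > 1\<close> until \<open>2 ^ j\<close> reaches \<open>X\<close> and
  decay with ratio \<open>r < 1\<close> afterwards, so the turning point dominates from both
  sides.\<close>

lemma sum_min_geometric_le:
  fixes b :: real
  assumes "0 < b" "b < 1"
  shows "\<exists>C>0. \<forall>X\<ge>1. \<forall>n. (\<Sum>j<n. 2 powr (- b * real j) * min 1 (2 ^ Suc j / X)) \<le> C * X powr (- b)"
proof -
  define q where "q = 2 powr (1 - b)"
  define r where "r = 2 powr (- b)"
  have q: "1 < q" using assms by (simp add: q_def)
  have r: "0 < r" "r < 1" using assms by (simp_all add: r_def powr_less_one)
  have qr: "r * 2 = q" by (simp add: q_def r_def powr_diff powr_minus field_simps)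
  have rpow: "2 powr (- b * real j) = r ^ j" for j
    by (simp add: r_def powr_realpow[symmetric] powr_powr)
  have qpow: "2 powr ((1 - b) * real j) = q ^ j" for j
    by (simp add: q_def powr_realpow[symmetric] powr_powr)
  define C where "C = 8 / (q - 1) + 1 / (1 - r)"
  have sum_q: "(\<Sum>j\<le>J. q ^ j) \<le> q ^ Suc J / (q - 1)" for J
  proof (induction J)
    case (Suc J)
    have "(\<Sum>j\<le>Suc J. q ^ j) \<le> q ^ Suc J / (q - 1) + q ^ Suc J" using Suc by simp
    also have "\<dots> = q ^ Suc (Suc J) / (q - 1)" using q by (simp add: field_simps)
    finally show ?case .
  qed (use q in \<open>simp add: field_simps\<close>)
  have sum_r: "(\<Sum>j\<in>{Suc J..<n}. r ^ j) \<le> r ^ Suc J / (1 - r)" for J n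
  proof -
    have "(\<Sum>j\<in>{Suc J..<Suc J + m}. r ^ j) = (r ^ Suc J - r ^ (Suc J + m)) / (1 - r)" for m
    proof (induction m)
      case (Suc m)
      have "(\<Sum>j\<in>{Suc J..<Suc J + Suc m}. r ^ j) = (r ^ Suc J - r ^ (Suc J + m)) / (1 - r) + r ^ (Suc J + m)"
        using Suc by simp
      also have "\<dots> = (r ^ Suc J - r ^ (Suc J + Suc m)) / (1 - r)"
        using r by (simp add: field_simps)
      finally show ?case .
    qed simp
    from this[of "n - Suc J"] have "Suc J \<le> n \<Longrightarrow> ?thesis"
      using r by (auto intro!: divide_right_mono)
    moreover have "\<not> Suc J \<le> n \<Longrightarrow> ?thesis" using r by simp
    ultimately show ?thesis by blast
  qed
  have "(\<Sum>j<n. 2 powr (- b * real j) * min 1 (2 ^ Suc j / X)) \<le> C * X powr (- b)" if X: "X \<ge> 1" for X n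
  proof -
    \<comment> \<open>The turning point, with \<open>2 ^ J \<le> X < 2 ^ (J + 1)\<close>.\<close>
    define J where "J = nat \<lfloor>log 2 X\<rfloor>"
    have "0 \<le> log 2 X" using X by simp
    hence J: "real J \<le> log 2 X" "log 2 X < real J + 1" by (auto simp: J_def)
    have J1: "2 powr real J \<le> X" "X \<le> 2 powr (real J + 1)"
      using J X by (simp_all add: le_log_iff log_less_iff less_imp_le)
    have "(\<Sum>j<n. 2 powr (- b * real j) * min 1 (2 ^ Suc j / X)) \<le>
       (\<Sum>j<n. if j \<le> J then 2 / X * q ^ j else r ^ j)"
    proof (rule sum_mono)
      fix j
      have "r ^ j * min 1 (2 ^ Suc j / X) \<le> r ^ j * 1" "r ^ j * min 1 (2 ^ Suc j / X) \<le> r ^ j * (2 ^ Suc j / X)"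
        using r by (intro mult_left_mono; simp)+
      moreover have "r ^ j * (2 ^ Suc j / X) = 2 / X * q ^ j"
        unfolding qr[symmetric] power_mult_distrib by simp
      ultimately show "2 powr (- b * real j) * min 1 (2 ^ Suc j / X) \<le> (if j \<le> J then 2 / X * q ^ j else r ^ j)"
        unfolding rpow by (cases "j \<le> J") (simp_all only: if_True if_False mult_1_right)
    qed
    also have "\<dots> = (\<Sum>j\<in>{..<n} \<inter> {j. j \<le> J}. 2 / X * q ^ j) + (\<Sum>j\<in>{..<n} \<inter> - {j. j \<le> J}. r ^ j)"
      by (rule sum.If_cases) simp
    also have "\<dots> \<le> (\<Sum>j\<le>J. 2 / X * q ^ j) + (\<Sum>j\<in>{Suc J..<n}. r ^ j)"
      using q r X by (intro add_mono sum_mono2) auto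
    also have "\<dots> \<le> 2 / X * (q ^ Suc J / (q - 1)) + r ^ Suc J / (1 - r)"
      using sum_q[of J] sum_r[of J n] X unfolding sum_distrib_left[symmetric]
      by (intro add_mono mult_left_mono) auto
    also have "\<dots> \<le> 2 / X * (4 * X powr (1 - b) / (q - 1)) + X powr (- b) / (1 - r)"
    proof -
      have "q ^ Suc J = 2 powr ((1 - b) * (real J + 1))" using qpow[of "Suc J"] by (simp add: add.commute)
      also have "\<dots> = 2 powr (1 - b) * (2 powr real J) powr (1 - b)"
        by (simp add: powr_powr powr_add[symmetric] algebra_simps)
      also have "\<dots> \<le> 2 powr 1 * X powr (1 - b)"
        using J1 assms by (intro mult_mono powr_mono2 powr_mono) auto
      also have "\<dots> \<le> 4 * X powr (1 - b)" by simp
      finally have 1: "q ^ Suc J \<le> 4 * X powr (1 - b)" .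
      have "r ^ Suc J = (2 powr (real J + 1)) powr (- b)"
        using rpow[of "Suc J"] by (simp add: powr_powr algebra_simps)
      also have "\<dots> \<le> X powr (- b)"
        using J1 assms X by (intro powr_mono2') auto
      finally have 2: "r ^ Suc J \<le> X powr (- b)" .
      show ?thesis using 1 2 q r X
        by (intro add_mono mult_left_mono divide_right_mono) auto
    qed
    also have "\<dots> = C * X powr (- b)"
    proof -
      have "X powr (1 - b) = X * X powr (- b)" using X by (simp add: powr_diff powr_minus divide_inverse)
      thus ?thesis using X by (simp add: C_def distrib_right)
    qed
    finally show ?thesis .
  qed
  moreover have "C > 0" using q r by (simp add: C_def add_pos_pos)
  ultimately show ?thesis by blast
qed

text \<open>The kept dyadic intervals of depth \<open>j\<close> are indexed by \<open>b < 2 ^ cnt Br j\<close>, and the \<open>b\<close>-th one has left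
  endpoint \<open>pos j b / 2 ^ j\<close>; they need not be enumerated in increasing order.\<close>

locale cantor_tree =
  fixes Br S :: "nat set" and pos :: "nat \<Rightarrow> nat \<Rightarrow> nat"
  assumes S_subset: "S \<subseteq> Br"
    and pos_0: "pos 0 b = 0"
    and pos_branch: "j \<in> Br \<Longrightarrow> pos (Suc j) b = 2 * pos j (b div 2) + b mod 2"
    and pos_choice: "j \<notin> Br \<Longrightarrow> \<exists>\<sigma>. (\<forall>a. \<sigma> a \<in> {-1, 1::real}) \<and>
       (\<forall>b. pos (Suc j) b = 2 * pos j b + (if pos j b \<in> pattern S j \<or> \<sigma> (pos j b) = -1 then 0 else 1)) \<and>
       (\<forall>\<theta>. norm (\<Sum>a\<in>pos j ` {..<2 ^ cnt Br j} - pattern S j. of_real (\<sigma> a) * cis (2 * pi * \<theta> * real a))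
          \<le> 16 * sqrt (real (Suc j) * 2 ^ cnt Br j))"
begin

abbreviation width :: "nat \<Rightarrow> nat" where "width j \<equiv> 2 ^ cnt Br j"

lemma pos_not_branch:
  assumes "j \<notin> Br"
  obtains e where "e \<le> 1" "pos (Suc j) b = 2 * pos j b + e" "pos j b \<in> pattern S j \<Longrightarrow> e = 0"
proof -
  obtain \<sigma> :: "nat \<Rightarrow> real" where \<sigma>: "\<And>b. pos (Suc j) b = 2 * pos j b + (if pos j b \<in> pattern S j \<or> \<sigma> (pos j b) = -1 then 0 else 1)"
    using pos_choice[OF assms] by blast
  show ?thesis
    by (rule that[of "if pos j b \<in> pattern S j \<or> \<sigma> (pos j b) = -1 then 0 else 1", OF _ \<sigma>]) auto
qed

lemma width_Suc: "width (Suc j) = (if j \<in> Br then 2 * width j else width j)"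
  by (simp add: cnt_Suc)

lemma inj_pos: "inj_on (pos j) {..<width j}"
proof (induction j)
  case (Suc j)
  show ?case
  proof (rule inj_onI)
    fix b c assume bc: "b \<in> {..<width (Suc j)}" "c \<in> {..<width (Suc j)}" and eq: "pos (Suc j) b = pos (Suc j) c"
    show "b = c"
    proof (cases "j \<in> Br")
      case True
      have "b div 2 \<in> {..<width j}" "c div 2 \<in> {..<width j}"
        using bc True unfolding width_Suc by auto
      moreover have "pos j (b div 2) = pos j (c div 2)" "b mod 2 = c mod 2"
        using eq True by (simp_all add: pos_branch) presburger+
      ultimately have "b div 2 = c div 2" using Suc by (auto dest: inj_onD)
      thus ?thesis using \<open>b mod 2 = c mod 2\<close> by (metis div_mult_mod_eq)
    next
      case False
      obtain e where e: "e \<le> 1" "pos (Suc j) b = 2 * pos j b + e" using pos_not_branch[OF False] by metis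
      obtain f where f: "f \<le> 1" "pos (Suc j) c = 2 * pos j c + f" using pos_not_branch[OF False] by metis
      have "pos j b = pos j c" using e f eq by presburger
      moreover have "b \<in> {..<width j}" "c \<in> {..<width j}" using bc False unfolding width_Suc by auto
      ultimately show ?thesis using Suc by (auto dest: inj_onD)
    qed
  qed
qed (simp add: inj_on_def)

text \<open>The structured subtree survives: levels in \<open>S\<close> branch, and at a level
  without branching its points take the left child, the only one that the pattern asks for.\<close>

lemma pattern_subset_pos: "pattern S j \<subseteq> pos j ` {..<width j}"
proof (induction j)
  case (Suc j)
  show ?case
  proof
    fix y assume y: "y \<in> pattern S (Suc j)"
    then obtain x e where x: "x \<in> pattern S j" and ye: "y = 2 * x + e" and e: "e = 0 \<or> (e = 1 \<and> j \<in> S)"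
    proof -
      have "y \<in> (\<lambda>y. 2 * y) ` pattern S j \<union> (if j \<in> S then (\<lambda>y. 2 * y + 1) ` pattern S j else {})"
        using y by simp
      thus ?thesis using that[of _ 0] that[of _ 1] by (auto split: if_splits)
    qed
    obtain b where b: "b < width j" "x = pos j b" using Suc x by blast
    show "y \<in> pos (Suc j) ` {..<width (Suc j)}"
    proof (cases "j \<in> Br")
      case True
      have "e \<le> 1" using e by auto
      hence "(2 * b + e) div 2 = b" "(2 * b + e) mod 2 = e" by presburger+
      hence "y = pos (Suc j) (2 * b + e)" using True ye b by (simp add: pos_branch)
      moreover have "2 * b + e < width (Suc j)" using True b \<open>e \<le> 1\<close> unfolding width_Suc by simp
      ultimately show ?thesis by blast
    next
      case False
      hence "e = 0" using e S_subset by blast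
      obtain f where "pos (Suc j) b = 2 * pos j b + f" "f = 0"
        using pos_not_branch[OF False, of b] x b(2) by metis
      hence "y = pos (Suc j) b" using \<open>e = 0\<close> ye b by simp
      thus ?thesis using b False unfolding width_Suc by auto
    qed
  qed
qed (simp add: pos_0)

section \<open>Coding by the unit interval and the image measure\<close>

text \<open>The leading \<open>cnt Br j\<close> binary digits of \<open>u\<close> name a kept
  interval of depth \<open>j\<close>. Lebesgue measure on \<open>[0, 1)\<close> thus gives all kept
  intervals of a depth equal weight, and the Cantor measure becomes a plain image measure.\<close>

definition cell :: "nat \<Rightarrow> real \<Rightarrow> nat" where
  "cell j u = nat \<lfloor>u * 2 ^ cnt Br j\<rfloor>"

definition approx_pt :: "nat \<Rightarrow> real \<Rightarrow> real" where
  "approx_pt j u = real (pos j (cell j u)) / 2 ^ j"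

definition cantor_pt :: "real \<Rightarrow> real" where
  "cantor_pt u = lim (\<lambda>j. approx_pt j u)"

definition U :: "real measure" where
  "U = restrict_space lborel {0..<1}"

definition \<mu> :: "real measure" where
  "\<mu> = distr U borel cantor_pt"

lemma cell_less: "u \<in> {0..<1} \<Longrightarrow> cell j u < width j"
  unfolding cell_def by (subst nat_less_iff) (auto simp: floor_less_iff)

lemma cell_eq_iff: "0 \<le> u \<Longrightarrow> cell j u = b \<longleftrightarrow> u \<in> {real b / 2 ^ cnt Br j ..< (real b + 1) / 2 ^ cnt Br j}"
proof -
  assume u: "0 \<le> u"
  have "cell j u = b \<longleftrightarrow> \<lfloor>u * 2 ^ cnt Br j\<rfloor> = int b"
    using u unfolding cell_def by auto
  also have "\<dots> \<longleftrightarrow> real b \<le> u * 2 ^ cnt Br j \<and> u * 2 ^ cnt Br j < real b + 1"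
    by (simp add: floor_eq_iff)
  finally show ?thesis by (simp add: field_simps)
qed

lemma cell_Suc_not_branch: "j \<notin> Br \<Longrightarrow> cell (Suc j) u = cell j u"
  by (simp add: cell_def cnt_Suc)

lemma cell_Suc_branch:
  assumes "j \<in> Br" "0 \<le> u"
  shows "cell (Suc j) u div 2 = cell j u"
proof -
  define x where "x = u * 2 ^ cnt Br (Suc j)"
  have "u * 2 ^ cnt Br j = x / of_int 2" using assms by (simp add: x_def cnt_Suc)
  hence "cell j u = nat (\<lfloor>x\<rfloor> div 2)"
    unfolding cell_def using floor_divide_real_eq_div[of 2 x] by (simp only: of_int_numeral)
  moreover have "cell (Suc j) u = nat \<lfloor>x\<rfloor>" by (simp add: cell_def x_def)
  moreover have "0 \<le> \<lfloor>x\<rfloor>" using assms by (simp add: x_def)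
  ultimately show ?thesis by (simp add: nat_div_distrib)
qed

lemma approx_pt_Suc:
  assumes "0 \<le> u"
  shows "approx_pt j u \<le> approx_pt (Suc j) u" "approx_pt (Suc j) u \<le> approx_pt j u + 1 / 2 ^ Suc j"
proof -
  have "\<exists>e\<le>1. pos (Suc j) (cell (Suc j) u) = 2 * pos j (cell j u) + e"
  proof (cases "j \<in> Br")
    case True
    thus ?thesis using cell_Suc_branch[OF True assms] pos_branch[OF True, of "cell (Suc j) u"]
      by (intro exI[of _ "cell (Suc j) u mod 2"]) auto
  next
    case False
    thus ?thesis using cell_Suc_not_branch[OF False] pos_not_branch[OF False] by metis
  qed
  then obtain e where e: "e \<le> 1" "pos (Suc j) (cell (Suc j) u) = 2 * pos j (cell j u) + e" by blast
  have "approx_pt (Suc j) u = approx_pt j u + real e / 2 ^ Suc j"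
    unfolding approx_pt_def e(2) by (simp add: field_simps)
  thus "approx_pt j u \<le> approx_pt (Suc j) u" "approx_pt (Suc j) u \<le> approx_pt j u + 1 / 2 ^ Suc j"
    using e(1) by (auto intro!: divide_right_mono)
qed

text \<open>Nesting of the dyadic intervals along the branch of \<open>u\<close>. The right endpoint
  of the inner interval has to be carried along for the induction to close.\<close>

lemma approx_pt_add:
  assumes "0 \<le> u"
  shows "approx_pt j u \<le> approx_pt (j + n) u \<and> approx_pt (j + n) u + 1 / 2 ^ (j + n) \<le> approx_pt j u + 1 / 2 ^ j"
proof (induction n)
  case (Suc n)
  have "1 / 2 ^ (j + n) = 2 * (1 / 2 ^ Suc (j + n) :: real)" by simp
  thus ?case using Suc approx_pt_Suc[OF assms, of "j + n"] by simp
qed simp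

lemma approx_pt_tendsto:
  assumes "0 \<le> u"
  shows "(\<lambda>j. approx_pt j u) \<longlonglongrightarrow> cantor_pt u"
proof -
  have "incseq (\<lambda>j. approx_pt j u)"
    using approx_pt_Suc(1)[OF assms] by (rule incseq_SucI)
  moreover have "approx_pt j u \<le> approx_pt 0 u + 1" for j
    using approx_pt_add[OF assms, of 0 j] by (smt (verit) add_0 divide_nonneg_nonneg power_0 div_by_1 zero_le_power)
  ultimately obtain L where "(\<lambda>j. approx_pt j u) \<longlonglongrightarrow> L"
    using incseq_convergent by blast
  thus ?thesis unfolding cantor_pt_def by (simp add: limI)
qed

lemma cantor_pt_bounds:
  assumes "0 \<le> u"
  shows "approx_pt j u \<le> cantor_pt u" "cantor_pt u \<le> approx_pt j u + 1 / 2 ^ j"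
proof -
  have lim: "(\<lambda>n. approx_pt (n + j) u) \<longlonglongrightarrow> cantor_pt u"
    using approx_pt_tendsto[OF assms] by (rule LIMSEQ_ignore_initial_segment)
  have "approx_pt j u \<le> approx_pt (n + j) u" for n
    using approx_pt_add[OF assms, of j n] by (simp add: add.commute)
  thus "approx_pt j u \<le> cantor_pt u" by (intro LIMSEQ_le_const[OF lim]) auto
  have "approx_pt (n + j) u \<le> approx_pt j u + 1 / 2 ^ j" for n
  proof -
    have "0 \<le> (1::real) / 2 ^ (j + n)" by simp
    thus ?thesis using conjunct2[OF approx_pt_add[OF assms, of j n]] unfolding add.commute[of n j] by linarith
  qed
  thus "cantor_pt u \<le> approx_pt j u + 1 / 2 ^ j" by (intro LIMSEQ_le_const2[OF lim]) auto
qed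

lemma space_U [simp]: "space U = {0..<1}"
  by (simp add: U_def space_restrict_space)

lemma finite_measure_U: "finite_measure U"
  by (rule finite_measureI) (simp add: U_def emeasure_restrict_space)

lemma measure_U_space: "measure U {0..<1} = 1"
  by (simp add: U_def measure_restrict_space)

lemma cell_measurable [measurable]: "cell j \<in> measurable U (count_space UNIV)"
  unfolding U_def cell_def by (rule measurable_restrict_space1) measurable

lemma approx_pt_measurable [measurable]: "approx_pt j \<in> borel_measurable U"
  unfolding approx_pt_def by measurable

lemma cantor_pt_measurable [measurable]: "cantor_pt \<in> borel_measurable U"
proof (rule borel_measurable_LIMSEQ_real)
  show "(\<lambda>j. approx_pt j u) \<longlonglongrightarrow> cantor_pt u" if "u \<in> space U" for u
    using that by (intro approx_pt_tendsto) simp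
qed measurable

lemma sets_\<mu> [simp, measurable_cong]: "sets \<mu> = sets borel"
  by (simp add: \<mu>_def)

lemma space_\<mu> [simp]: "space \<mu> = UNIV"
  by (simp add: \<mu>_def)

lemma finite_measure_\<mu>: "finite_measure \<mu>"
  unfolding \<mu>_def by (rule finite_measure.finite_measure_distr[OF finite_measure_U]) measurable

lemma measure_\<mu>: "A \<in> sets borel \<Longrightarrow> measure \<mu> A = measure U {u \<in> {0..<1}. cantor_pt u \<in> A}"
  unfolding \<mu>_def by (subst measure_distr) (auto intro!: arg_cong[where f = "measure U"])

lemma measure_cell:
  assumes "b < width j"
  shows "measure U {u \<in> {0..<1}. cell j u = b} = 1 / 2 ^ cnt Br j"
proof -
  have b: "real b + 1 \<le> 2 ^ cnt Br j"
  proof -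
    have "real (Suc b) \<le> real (width j)" using assms by (intro of_nat_mono) simp
    thus ?thesis by simp
  qed
  let ?I = "{real b / 2 ^ cnt Br j ..< (real b + 1) / 2 ^ cnt Br j}"
  have le: "(real b + 1) / 2 ^ cnt Br j \<le> 1" "0 \<le> real b / 2 ^ cnt Br j" using b by simp_all
  hence sub: "?I \<subseteq> {0..<1}" by (auto simp del: zero_le_divide_iff divide_le_eq_1_pos)
  have "u \<in> {u \<in> {0..<1}. cell j u = b} \<longleftrightarrow> u \<in> {0..<1} \<inter> ?I" for u
  proof -
    have "u \<in> ?I \<Longrightarrow> 0 \<le> u" using order_trans[OF le(2)] by simp
    thus ?thesis using cell_eq_iff[of u j b] by (cases "0 \<le> u") auto
  qed
  hence "{u \<in> {0..<1}. cell j u = b} = {0..<1} \<inter> ?I" by blast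
  hence "{u \<in> {0..<1}. cell j u = b} = ?I" using sub by blast
  with sub show ?thesis
    by (simp add: U_def measure_restrict_space diff_divide_distrib[symmetric] divide_right_mono)
qed

lemma cell_sets: "{u \<in> {0..<1}. cell j u \<in> Q} \<in> sets U"
  using measurable_sets[OF cell_measurable, of Q j] by (simp add: vimage_def Int_def conj_commute)

lemma measure_cells:
  assumes "Q \<subseteq> {..<width j}"
  shows "measure U {u \<in> {0..<1}. cell j u \<in> Q} = real (card Q) / 2 ^ cnt Br j"
proof -
  have fin: "finite Q" using assms finite_subset by blast
  have "{u \<in> {0..<1}. cell j u \<in> Q} = (\<Union>b\<in>Q. {u \<in> {0..<1}. cell j u = b})" by auto
  also have "measure U \<dots> = (\<Sum>b\<in>Q. measure U {u \<in> {0..<1}. cell j u = b})"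
    using fin cell_sets[of j "{_}"]
    by (intro finite_measure.finite_measure_finite_Union[OF finite_measure_U]) (auto simp: disjoint_family_on_def)
  also have "\<dots> = (\<Sum>b\<in>Q. 1 / 2 ^ cnt Br j)"
    using assms by (intro sum.cong measure_cell) auto
  finally show ?thesis by simp
qed

lemma integral_cell:
  fixes g :: "nat \<Rightarrow> complex"
  shows "(LINT u|U. g (cell j u)) = (\<Sum>b<width j. g b) / 2 ^ cnt Br j"
proof -
  define I where "I b = {u \<in> {0..<1}. cell j u = b}" for b
  have I: "I b \<in> sets U" "I b \<inter> space U = I b" "emeasure U (I b) < \<infinity>" for b
    using cell_sets[of j "{b}"]
    by (auto simp: I_def finite_measure.emeasure_eq_measure[OF finite_measure_U])
  have int: "integrable U (\<lambda>u. indicator (I b) u *\<^sub>R g b)" for b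
    using I[of b] by (intro integrable_scaleR_left integrable_real_indicator) auto
  have ind: "(LINT u|U. indicator (I b) u *\<^sub>R g b) = g b / 2 ^ cnt Br j" if "b < width j" for b
  proof -
    have "(LINT u|U. indicator (I b) u *\<^sub>R g b) = (LINT u|U. indicator (I b) u :: real) *\<^sub>R g b"
      using I[of b] by (intro integral_scaleR_left integrable_real_indicator) auto
    also have "(LINT u|U. indicator (I b) u :: real) = 1 / 2 ^ cnt Br j"
      using measure_cell[OF that] I(2)[of b] unfolding Bochner_Integration.integral_indicator I_def by simp
    finally show ?thesis by (simp add: scaleR_conv_of_real)
  qed
  have "(LINT u|U. g (cell j u)) = (LINT u|U. (\<Sum>b<width j. indicator (I b) u *\<^sub>R g b))"
  proof (rule Bochner_Integration.integral_cong[OF refl])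
    fix u assume "u \<in> space U"
    hence u: "u \<in> {0..<1}" by simp
    have "(\<Sum>b<width j. indicator (I b) u *\<^sub>R g b) = (\<Sum>b<width j. if b = cell j u then g b else 0)"
      using u by (intro sum.cong) (auto simp: I_def)
    also have "\<dots> = g (cell j u)" using cell_less[OF u] by simp
    finally show "g (cell j u) = (\<Sum>b<width j. indicator (I b) u *\<^sub>R g b)" ..
  qed
  also have "\<dots> = (\<Sum>b<width j. (LINT u|U. indicator (I b) u *\<^sub>R g b))"
    by (intro Bochner_Integration.integral_sum int)
  also have "\<dots> = (\<Sum>b<width j. g b / 2 ^ cnt Br j)" using ind by (intro sum.cong) auto
  finally show ?thesis by (simp add: sum_divide_distrib)
qed

section \<open>Fourier decay by telescoping over the depths\<close>

definition phi :: "nat \<Rightarrow> complex \<Rightarrow> complex" where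
  "phi j w = (\<Sum>b<width j. exp (w * of_real (real (pos j b) / 2 ^ j))) / 2 ^ cnt Br j"

text \<open>\<open>psi j\<close> is the transform of the measure distributing mass evenly over the kept intervals of depth
  \<open>j\<close>. Unlike for \<open>phi\<close>, a branching level does not change it, and a sign choice changes it by a
  mean-zero amount.\<close>

definition psi :: "nat \<Rightarrow> complex \<Rightarrow> complex" where
  "psi j w = phi j w * exp_avg (w / 2 ^ j)"

lemma phi_eq_integral: "phi j w = (LINT u|U. exp (w * of_real (approx_pt j u)))"
  unfolding phi_def approx_pt_def
  using integral_cell[of "\<lambda>b. exp (w * of_real (real (pos j b) / 2 ^ j))" j] by simp

lemma norm_phi_le:
  assumes "Re w = 0"
  shows "norm (phi j w) \<le> 1"
proof -
  have "norm (\<Sum>b<width j. exp (w * of_real (real (pos j b) / 2 ^ j))) \<le> (\<Sum>b<width j. 1)"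
    using assms by (intro sum_norm_le) simp
  thus ?thesis unfolding phi_def by (simp add: norm_divide norm_power)
qed

lemma phi_tendsto_fourier:
  "(\<lambda>j. phi j (- 2 * of_real pi * \<i> * of_real \<xi>)) \<longlonglongrightarrow> fourier_measure \<mu> (\<lambda>_. 1) \<xi>"
proof -
  let ?w = "- 2 * of_real pi * \<i> * of_real \<xi> :: complex"
  have "fourier_measure \<mu> (\<lambda>_. 1) \<xi> = (LINT u|U. exp (?w * of_real (cantor_pt u)))"
    unfolding fourier_measure_def \<mu>_def by (subst integral_distr) (simp_all add: mult_ac)
  moreover have "(\<lambda>j. LINT u|U. exp (?w * of_real (approx_pt j u))) \<longlonglongrightarrow> (LINT u|U. exp (?w * of_real (cantor_pt u)))"
  proof (rule integral_dominated_convergence[where w = "\<lambda>_. 1"])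
    show "integrable U (\<lambda>_. 1::real)" using finite_measure.integrable_const[OF finite_measure_U] .
    show "AE u in U. (\<lambda>j. exp (?w * of_real (approx_pt j u))) \<longlonglongrightarrow> exp (?w * of_real (cantor_pt u))"
      by (intro AE_I2 tendsto_intros approx_pt_tendsto) simp
    show "\<And>j. AE u in U. norm (exp (?w * of_real (approx_pt j u))) \<le> 1"
      by (intro AE_I2) simp
  qed measurable
  ultimately show ?thesis by (simp only: phi_eq_integral)
qed

lemma psi_tendsto_fourier:
  "(\<lambda>j. psi j (- 2 * of_real pi * \<i> * of_real \<xi>)) \<longlonglongrightarrow> fourier_measure \<mu> (\<lambda>_. 1) \<xi>"
  using tendsto_mult[OF phi_tendsto_fourier[of \<xi>] exp_avg_tendsto_1[of "- 2 * of_real pi * \<i> * of_real \<xi>"]]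
  unfolding psi_def by simp

lemma exp_child:
  fixes w :: complex
  shows "exp (w * of_real (real (2 * p + e) / 2 ^ Suc j)) = exp (w * of_real (real p / 2 ^ j)) * exp (of_nat e * (w / 2 ^ Suc j))"
  unfolding exp_add[symmetric] by (intro arg_cong[where f = exp]) (simp add: field_simps)

lemma exp_avg_half: "exp_avg (w / 2 ^ j) = exp_avg (w / 2 ^ Suc j) * ((1 + exp (w / 2 ^ Suc j)) / 2)"
  using exp_avg_double[of "w / 2 ^ Suc j"] by simp

lemma psi_branch:
  assumes "j \<in> Br"
  shows "psi (Suc j) w = psi j w"
proof -
  let ?g = "\<lambda>c. exp (w * of_real (real (pos j c) / 2 ^ j))"
  have "(\<Sum>b<width (Suc j). exp (w * of_real (real (pos (Suc j) b) / 2 ^ Suc j)))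
      = (\<Sum>b<2 * width j. ?g (b div 2) * exp (of_nat (b mod 2) * (w / 2 ^ Suc j)))"
    using assms unfolding width_Suc by (simp only: if_True pos_branch exp_child)
  also have "\<dots> = (\<Sum>c<width j. ?g c * exp (of_nat 0 * (w / 2 ^ Suc j)) + ?g c * exp (of_nat 1 * (w / 2 ^ Suc j)))"
    by (rule sum_div_mod_2)
  also have "\<dots> = (\<Sum>c<width j. ?g c) * (1 + exp (w / 2 ^ Suc j))"
    by (simp add: sum.distrib distrib_left flip: sum_distrib_right)
  finally have "phi (Suc j) w = phi j w * ((1 + exp (w / 2 ^ Suc j)) / 2)"
    using assms unfolding phi_def by (simp add: cnt_Suc)
  thus ?thesis unfolding psi_def exp_avg_half[of w j] by simp
qed

text \<open>Picking one child instead of averaging over both shifts each summand by the same factor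
  \<open>(1 - exp z) / 2\<close>, up to a sign. What remains is a signed exponential sum: the
  subtree part is bounded by its number of terms, the rest by the choice of signs.\<close>

lemma psi_choice:
  fixes \<xi> :: real
  assumes "j \<notin> Br"
  defines "w \<equiv> - 2 * of_real pi * \<i> * of_real \<xi> :: complex"
  shows "norm (psi (Suc j) w - psi j w) \<le>
    (2 ^ cnt S j + 16 * sqrt (real (Suc j) * 2 ^ cnt Br j)) / 2 ^ cnt Br j * norm (exp_avg (w / 2 ^ Suc j))"
proof -
  obtain \<sigma> :: "nat \<Rightarrow> real" where \<sigma>: "\<And>a. \<sigma> a \<in> {-1, 1}"
    and pos: "\<And>b. pos (Suc j) b = 2 * pos j b + (if pos j b \<in> pattern S j \<or> \<sigma> (pos j b) = -1 then 0 else 1)"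
    and bd: "\<And>\<theta>. norm (\<Sum>a\<in>pos j ` {..<2 ^ cnt Br j} - pattern S j. of_real (\<sigma> a) * cis (2 * pi * \<theta> * real a))
          \<le> 16 * sqrt (real (Suc j) * 2 ^ cnt Br j)"
    using pos_choice[OF assms(1)] by blast
  define z where "z = w / 2 ^ Suc j"
  define s where "s p = (if p \<in> pattern S j \<or> \<sigma> p = -1 then 1 else -1 :: complex)" for p
  define G where "G p = exp (w * of_real (real p / 2 ^ j))" for p :: nat
  let ?I = "pos j ` {..<width j}"
  \<comment> \<open>The sign \<open>s\<close> is 1 for a left child and -1 for a right one; off the
    pattern it equals minus \<sigma>.\<close>
  have child: "exp (w * of_real (real (pos (Suc j) b) / 2 ^ Suc j)) - G (pos j b) * ((1 + exp z) / 2)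
      = (1 - exp z) / 2 * (s (pos j b) * G (pos j b))" for b
  proof (cases "pos j b \<in> pattern S j \<or> \<sigma> (pos j b) = -1")
    case True
    thus ?thesis unfolding pos exp_child z_def G_def s_def
      by (simp only: if_True) (simp add: field_simps)
  next
    case False
    thus ?thesis unfolding pos exp_child z_def G_def s_def
      by (simp only: if_False) (simp add: field_simps)
  qed
  have "phi (Suc j) w - phi j w * ((1 + exp z) / 2) =
      (\<Sum>b<width j. exp (w * of_real (real (pos (Suc j) b) / 2 ^ Suc j)) - G (pos j b) * ((1 + exp z) / 2)) / 2 ^ cnt Br j"
    using assms(1) unfolding phi_def G_def[symmetric]
    by (simp add: cnt_Suc sum_subtractf sum_distrib_right diff_divide_distrib sum_divide_distrib mult.commute[of 2])
  also have "\<dots> = (1 - exp z) / 2 * (\<Sum>b<width j. s (pos j b) * G (pos j b)) / 2 ^ cnt Br j"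
    unfolding child by (simp add: sum_distrib_left)
  also have "(\<Sum>b<width j. s (pos j b) * G (pos j b)) = (\<Sum>p\<in>?I. s p * G p)"
    using inj_pos by (simp add: sum.reindex)
  finally have phi: "phi (Suc j) w - phi j w * ((1 + exp z) / 2) = (1 - exp z) / 2 * (\<Sum>p\<in>?I. s p * G p) / 2 ^ cnt Br j" .
  have "psi (Suc j) w - psi j w = (phi (Suc j) w - phi j w * ((1 + exp z) / 2)) * exp_avg z"
    unfolding psi_def exp_avg_half[of w j] z_def[symmetric] by (simp add: algebra_simps)
  hence "psi (Suc j) w - psi j w = (1 - exp z) / 2 * (\<Sum>p\<in>?I. s p * G p) / 2 ^ cnt Br j * exp_avg z"
    unfolding phi .
  hence eq: "norm (psi (Suc j) w - psi j w) = norm ((1 - exp z) / 2) * norm (\<Sum>p\<in>?I. s p * G p) / 2 ^ cnt Br j * norm (exp_avg z)"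
    by (simp add: norm_mult norm_divide norm_power)
  have normG: "norm (G p) = 1" for p
    by (simp add: G_def w_def)
  have "(\<Sum>p\<in>?I. s p * G p) = (\<Sum>p\<in>?I - pattern S j. s p * G p) + (\<Sum>p\<in>pattern S j. s p * G p)"
    using pattern_subset_pos by (intro sum.subset_diff) auto
  also have "(\<Sum>p\<in>?I - pattern S j. s p * G p) = - (\<Sum>p\<in>?I - pattern S j. of_real (\<sigma> p) * cis (2 * pi * (- \<xi> / 2 ^ j) * real p))"
    unfolding sum_negf[symmetric]
  proof (rule sum.cong[OF refl])
    fix p assume "p \<in> ?I - pattern S j"
    hence "s p = - of_real (\<sigma> p)" using \<sigma>[of p] by (auto simp: s_def)
    moreover have "G p = cis (2 * pi * (- \<xi> / 2 ^ j) * real p)"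
      unfolding G_def w_def cis_conv_exp by (intro arg_cong[where f = exp]) (simp add: field_simps)
    ultimately show "s p * G p = - (of_real (\<sigma> p) * cis (2 * pi * (- \<xi> / 2 ^ j) * real p))" by simp
  qed
  finally have "norm (\<Sum>p\<in>?I. s p * G p) \<le> norm (\<Sum>p\<in>?I - pattern S j. of_real (\<sigma> p) * cis (2 * pi * (- \<xi> / 2 ^ j) * real p))
      + norm (\<Sum>p\<in>pattern S j. s p * G p)"
    using norm_triangle_ineq[of "- A" B for A B] unfolding norm_minus_cancel by (simp only:)
  also have "norm (\<Sum>p\<in>pattern S j. s p * G p) \<le> (\<Sum>p\<in>pattern S j. 1)"
    by (intro sum_norm_le) (simp add: norm_mult normG s_def)
  also have "\<dots> = 2 ^ cnt S j" by (simp add: card_pattern)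
  finally have sum_le: "norm (\<Sum>p\<in>?I. s p * G p) \<le> 2 ^ cnt S j + 16 * sqrt (real (Suc j) * 2 ^ cnt Br j)"
    using bd[of "- \<xi> / 2 ^ j"] by linarith
  have "Re z = 0" by (simp add: z_def w_def)
  hence "norm ((1 - exp z) / 2) \<le> 1"
    using norm_triangle_ineq4[of 1 "exp z"] by (simp add: norm_divide)
  hence "norm ((1 - exp z) / 2) * norm (\<Sum>p\<in>?I. s p * G p) \<le> 1 * (2 ^ cnt S j + 16 * sqrt (real (Suc j) * 2 ^ cnt Br j))"
    using sum_le by (intro mult_mono) auto
  thus ?thesis unfolding eq z_def[symmetric]
    by (intro mult_right_mono divide_right_mono) auto
qed

text \<open>\<open>psi\<close> is telescoped from depth 0. At depths coarse compared with
  \<open>1 / \<bar>\<xi>\<bar>\<close> the averaging factor supplies the smallness, at finer depths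
  the hypothesis \<open>C\<close> does.\<close>

lemma fourier_decay_\<mu>:
  assumes \<beta>: "0 < \<beta>" "\<beta> < 2"
    and C: "\<And>j. (2 ^ cnt S j + 16 * sqrt (real (Suc j) * 2 ^ cnt Br j)) / 2 ^ cnt Br j \<le> C * 2 powr (- (\<beta> / 2) * real j)"
  shows "fourier_decay \<beta> \<mu>"
proof -
  have C0: "0 < C"
  proof -
    have "0 < (2 ^ cnt S 0 + 16 * sqrt (real (Suc 0) * 2 ^ cnt Br 0)) / (2 ^ cnt Br 0 :: real)" by simp
    thus ?thesis using C[of 0] by simp
  qed
  obtain D where D: "D > 0" "\<And>X n. X \<ge> 1 \<Longrightarrow> (\<Sum>j<n. 2 powr (- (\<beta> / 2) * real j) * min 1 (2 ^ Suc j / X)) \<le> D * X powr (- (\<beta> / 2))"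
    using sum_min_geometric_le[of "\<beta> / 2"] \<beta> by auto
  have "norm (fourier_measure \<mu> (\<lambda>_. 1) \<xi>) \<le> (1 + C * D) * \<bar>\<xi>\<bar> powr (- \<beta> / 2)" if \<xi>: "\<xi> \<noteq> 0" for \<xi>
  proof (cases "\<bar>\<xi>\<bar> \<ge> 1")
    \<comment> \<open>For small frequencies the trivial bound suffices, as the negative power of
      \<open>\<bar>\<xi>\<bar>\<close> is at least 1.\<close>
    case False
    have "norm (fourier_measure \<mu> (\<lambda>_. 1) \<xi>) \<le> 1"
      by (rule LIMSEQ_le_const2[OF tendsto_norm[OF phi_tendsto_fourier]]) (auto intro!: norm_phi_le)
    also have "1 \<le> \<bar>\<xi>\<bar> powr (- \<beta> / 2)"
      using powr_mono2'[of "- \<beta> / 2" "\<bar>\<xi>\<bar>" 1] False \<xi> \<beta> by simp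
    also have "\<dots> \<le> (1 + C * D) * \<bar>\<xi>\<bar> powr (- \<beta> / 2)"
      using C0 D(1) mult_right_mono[of 1 "1 + C * D" "\<bar>\<xi>\<bar> powr (- \<beta> / 2)"] by simp
    finally show ?thesis .
  next
    case True
    define w where "w = (- 2 * of_real pi * \<i> * of_real \<xi> :: complex)"
    have Rew: "Re (w / 2 ^ j) = 0" for j by (simp add: w_def)
    have w0: "w \<noteq> 0" using \<xi> by (simp add: w_def)
    have avg: "norm (exp_avg (w / 2 ^ j)) \<le> min 1 (2 ^ j / \<bar>\<xi>\<bar>)" for j
    proof -
      have "norm (exp_avg (w / 2 ^ j)) \<le> 2 / norm (w / 2 ^ j)"
        using w0 by (intro norm_exp_avg_le Rew) simp
      also have "\<dots> = 2 ^ j / \<bar>\<xi>\<bar> / pi" by (simp add: w_def norm_divide norm_mult norm_power)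
      also have "\<dots> \<le> 2 ^ j / \<bar>\<xi>\<bar> / 1" using pi_gt3 by (intro divide_left_mono) auto
      finally show ?thesis using norm_exp_avg_le_1[OF Rew, of j] by simp
    qed
    have step: "norm (psi (Suc j) w - psi j w) \<le> C * (2 powr (- (\<beta> / 2) * real j) * min 1 (2 ^ Suc j / \<bar>\<xi>\<bar>))" for j
    proof (cases "j \<in> Br")
      case True
      thus ?thesis using C0 by (simp add: psi_branch)
    next
      case False
      have "norm (psi (Suc j) w - psi j w) \<le>
        (2 ^ cnt S j + 16 * sqrt (real (Suc j) * 2 ^ cnt Br j)) / 2 ^ cnt Br j * norm (exp_avg (w / 2 ^ Suc j))"
        unfolding w_def by (rule psi_choice[OF False])
      also have "\<dots> \<le> C * 2 powr (- (\<beta> / 2) * real j) * min 1 (2 ^ Suc j / \<bar>\<xi>\<bar>)"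
        using C0 by (intro mult_mono C avg) auto
      finally show ?thesis by (simp only: mult.assoc)
    qed
    have "norm (psi n w) \<le> norm (psi 0 w) + (\<Sum>j<n. C * (2 powr (- (\<beta> / 2) * real j) * min 1 (2 ^ Suc j / \<bar>\<xi>\<bar>)))" for n
    proof (induction n)
      case (Suc n)
      have "norm (psi (Suc n) w) \<le> norm (psi n w) + norm (psi (Suc n) w - psi n w)"
        by (rule norm_triangle_sub)
      thus ?case using Suc step[of n] unfolding sum.lessThan_Suc by linarith
    qed simp
    \<comment> \<open>Depth 0 is the uniform distribution on \<open>[0, 1]\<close>, whose transform
      decays like \<open>1 / \<bar>\<xi>\<bar>\<close>; \<open>\<beta> / 2 < 1\<close> makes that
      enough.\<close>
    moreover have "norm (psi 0 w) \<le> 1 * \<bar>\<xi>\<bar> powr (- \<beta> / 2)"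
    proof -
      have "psi 0 w = exp_avg (w / 2 ^ 0)" by (simp add: psi_def phi_def pos_0)
      hence "norm (psi 0 w) \<le> 1 / \<bar>\<xi>\<bar>" using avg[of 0] by simp
      also have "\<dots> = \<bar>\<xi>\<bar> powr (-1)" using \<xi> by (simp add: powr_minus_divide)
      also have "\<dots> \<le> \<bar>\<xi>\<bar> powr (- \<beta> / 2)" using True \<beta> by (intro powr_mono) auto
      finally show ?thesis by simp
    qed
    moreover have "(\<Sum>j<n. C * (2 powr (- (\<beta> / 2) * real j) * min 1 (2 ^ Suc j / \<bar>\<xi>\<bar>))) \<le> C * D * \<bar>\<xi>\<bar> powr (- \<beta> / 2)" for n
      using D(2)[OF True, of n] C0 by (simp add: sum_distrib_left[symmetric] mult.assoc)
    ultimately have "norm (psi n w) \<le> (1 + C * D) * \<bar>\<xi>\<bar> powr (- \<beta> / 2)" for n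
      unfolding distrib_right by (meson add_mono order_trans)
    thus ?thesis unfolding w_def
      by (intro LIMSEQ_le_const2[OF tendsto_norm[OF psi_tendsto_fourier]]) auto
  qed
  moreover have "1 + C * D > 0" using C0 D(1) by (simp add: add_pos_pos)
  ultimately show ?thesis unfolding fourier_decay_def by blast
qed

section \<open>Support and mass of balls\<close>

definition ival :: "nat \<Rightarrow> nat \<Rightarrow> real set" where
  "ival j b = {real (pos j b) / 2 ^ j .. (real (pos j b) + 1) / 2 ^ j}"

text \<open>Intersecting finite unions of closed intervals makes compactness immediate. The set may
  contain points outside the range of \<open>cantor_pt\<close>, but each of its points lies in a
  kept interval of every depth, which is all that the lower ball estimate asks.\<close>

definition E :: "real set" where
  "E = (\<Inter>j. \<Union>b<width j. ival j b)"

lemma compact_E: "compact E"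
proof -
  have "closed E" unfolding E_def ival_def by (intro closed_INT ballI closed_UN) auto
  moreover have "compact (\<Union>b<width 0. ival 0 b)" unfolding ival_def by (intro compact_UN) auto
  ultimately have "compact ((\<Union>b<width 0. ival 0 b) \<inter> E)" by (rule compact_Int_closed[rotated])
  moreover have "(\<Union>b<width 0. ival 0 b) \<inter> E = E" unfolding E_def by blast
  ultimately show ?thesis by simp
qed

lemma cantor_pt_in_ival: "u \<in> {0..<1} \<Longrightarrow> cantor_pt u \<in> ival j (cell j u)"
  using cantor_pt_bounds[of u j] by (simp add: ival_def approx_pt_def add_divide_distrib)

lemma supported_on_\<mu>: "supported_on \<mu> E"
proof -
  have "cantor_pt u \<in> E" if "u \<in> {0..<1}" for u
    using cantor_pt_in_ival[OF that] cell_less[OF that] unfolding E_def by blast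
  hence "{u \<in> {0..<1}. cantor_pt u \<in> - E} = {}" by blast
  moreover have "- E \<in> sets borel" using compact_E by (simp add: borel_closed compact_imp_closed)
  ultimately have "measure \<mu> (- E) = 0" using measure_\<mu>[of "- E"] by (simp only: measure_empty)
  thus ?thesis unfolding supported_on_def
    by (simp add: finite_measure.emeasure_eq_measure[OF finite_measure_\<mu>])
qed

lemma measure_ivals_ge:
  assumes "Q \<subseteq> {..<width j}"
  shows "real (card Q) / 2 ^ cnt Br j \<le> measure \<mu> (\<Union>b\<in>Q. ival j b)"
proof -
  have fin: "finite Q" using assms finite_subset by blast
  have meas: "(\<Union>b\<in>Q. ival j b) \<in> sets borel"
    using fin by (intro borel_closed closed_UN) (auto simp: ival_def)
  have "{u \<in> {0..<1}. cantor_pt u \<in> (\<Union>b\<in>Q. ival j b)} = cantor_pt -` (\<Union>b\<in>Q. ival j b) \<inter> space U" by auto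
  hence "{u \<in> {0..<1}. cantor_pt u \<in> (\<Union>b\<in>Q. ival j b)} \<in> sets U"
    using measurable_sets[OF cantor_pt_measurable meas] by simp
  moreover have "{u \<in> {0..<1}. cell j u \<in> Q} \<subseteq> {u \<in> {0..<1}. cantor_pt u \<in> (\<Union>b\<in>Q. ival j b)}"
    using cantor_pt_in_ival by blast
  ultimately show ?thesis
    unfolding measure_\<mu>[OF meas] measure_cells[OF assms, symmetric]
    by (intro finite_measure.finite_measure_mono[OF finite_measure_U])
qed

text \<open>Distinct indices have distinct positions, and an interval of length
  \<open>1 / 2 ^ j\<close> meeting the ball has its position within one of the integer part of the
  rescaled centre: three candidates.\<close>

lemma measure_ball_le:
  assumes "r \<le> 1 / 2 ^ j"
  shows "measure \<mu> (ball x r) \<le> 3 / 2 ^ cnt Br j"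
proof -
  define y where "y = x * 2 ^ j"
  define Q where "Q = {b \<in> {..<width j}. int (pos j b) \<in> {\<lfloor>y\<rfloor> - 1..\<lfloor>y\<rfloor> + 1}}"
  have "card Q = card ((\<lambda>b. int (pos j b)) ` Q)"
    using inj_pos[of j] by (intro card_image[symmetric]) (auto simp: Q_def inj_on_def)
  also have "\<dots> \<le> card {\<lfloor>y\<rfloor> - 1..\<lfloor>y\<rfloor> + 1}" by (intro card_mono) (auto simp: Q_def)
  finally have cQ: "card Q \<le> 3" by simp
  have "{u \<in> {0..<1}. cantor_pt u \<in> ball x r} \<subseteq> {u \<in> {0..<1}. cell j u \<in> Q}"
  proof (intro subsetI CollectI conjI; elim CollectE conjE)
    fix u assume u: "u \<in> {0..<1}" and ball: "cantor_pt u \<in> ball x r"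
    have "\<bar>cantor_pt u - x\<bar> < 1 / 2 ^ j" using ball assms by (simp add: dist_real_def abs_minus_commute)
    hence "\<bar>cantor_pt u - x\<bar> * 2 ^ j < 1" by (simp add: field_simps)
    hence 1: "\<bar>cantor_pt u * 2 ^ j - y\<bar> < 1" by (simp add: y_def abs_mult flip: left_diff_distrib)
    have 2: "real (pos j (cell j u)) \<le> cantor_pt u * 2 ^ j" "cantor_pt u * 2 ^ j \<le> real (pos j (cell j u)) + 1"
      using cantor_pt_in_ival[OF u, of j] by (simp_all add: ival_def field_simps)
    have "int (pos j (cell j u)) \<in> {\<lfloor>y\<rfloor> - 1..\<lfloor>y\<rfloor> + 1}"
      using 1 2 by simp linarith
    thus "cell j u \<in> Q" using cell_less[OF u] by (simp add: Q_def)
  qed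
  hence "measure \<mu> (ball x r) \<le> measure U {u \<in> {0..<1}. cell j u \<in> Q}"
    unfolding measure_\<mu>[OF borel_open[OF open_ball]]
    by (rule finite_measure.finite_measure_mono[OF finite_measure_U _ cell_sets])
  also have "\<dots> = real (card Q) / 2 ^ cnt Br j" by (rule measure_cells) (auto simp: Q_def)
  also have "\<dots> \<le> 3 / 2 ^ cnt Br j" using cQ by (intro divide_right_mono) auto
  finally show ?thesis .
qed

lemma measure_ball_ge:
  assumes "x \<in> E" "1 / 2 ^ j < r"
  shows "1 / 2 ^ cnt Br j \<le> measure \<mu> (ball x r)"
proof -
  obtain b where b: "b < width j" "x \<in> ival j b" using assms(1) unfolding E_def by blast
  have "ival j b \<subseteq> ball x r"
  proof
    fix y assume "y \<in> ival j b"
    hence "\<bar>x - y\<bar> \<le> 1 / 2 ^ j" using b(2) unfolding ival_def add_divide_distrib by auto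
    thus "y \<in> ball x r" using assms(2) by (simp add: dist_real_def)
  qed
  hence "measure \<mu> (ival j b) \<le> measure \<mu> (ball x r)"
    by (intro finite_measure.finite_measure_mono[OF finite_measure_\<mu>]) auto
  thus ?thesis using measure_ivals_ge[of "{b}" j] b(1) by simp
qed

text \<open>The dependence on \<epsilon> is confined to \<open>D\<close>, hence to the
  multiplicative constant, so one radius serves every \<epsilon>.\<close>

lemma ball_condition_\<mu>:
  assumes \<alpha>: "0 < \<alpha>" and \<epsilon>: "0 < \<epsilon>"
    and lower: "\<And>j. \<alpha> * real j - C \<le> real (cnt Br j)"
    and upper: "\<And>j. real (cnt Br j) \<le> (\<alpha> + \<epsilon>) * real j + D"
  shows "ball_condition \<alpha> \<epsilon> (1 / 8) \<mu> E"
proof -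
  have "r powr (\<alpha> + \<epsilon>) \<le> 2 powr (D + \<alpha> + \<epsilon>) * measure \<mu> (ball x r) \<and>
      measure \<mu> (ball x r) \<le> 3 * 2 powr (C + \<alpha>) * r powr \<alpha>"
    if r: "0 < r" "r < 1 / 8" and x: "x \<in> E" for r x
  proof -
    \<comment> \<open>The depth with \<open>1 / 2 ^ Suc j < r \<le> 1 / 2 ^ j\<close>: the upper
      bound works at depth \<open>j\<close>, the lower one at \<open>Suc j\<close>.\<close>
    define j where "j = nat \<lfloor>- log 2 r\<rfloor>"
    have "0 \<le> - log 2 r" using r by simp
    hence j: "real j \<le> - log 2 r" "- log 2 r < real j + 1" by (auto simp: j_def)
    have r_eq: "r = 2 powr (log 2 r)" using r by simp
    have "r \<le> 2 powr (- real j)" by (subst r_eq, rule powr_mono) (use j in auto)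
    hence r1: "r \<le> 1 / 2 ^ j" by (simp add: powr_minus_divide powr_realpow)
    have "2 powr (- real (Suc j)) < r" by (subst r_eq, rule powr_less_mono) (use j in auto)
    hence r2: "1 / 2 ^ Suc j < r" by (simp only: powr_minus_divide powr_realpow zero_less_numeral)
    have pw: "2 powr (- real n) = 1 / 2 ^ n" for n by (simp add: powr_minus_divide powr_realpow)
    have "r powr (\<alpha> + \<epsilon>) \<le> (2 powr (- real j)) powr (\<alpha> + \<epsilon>)"
      using r1 r \<alpha> \<epsilon> unfolding pw by (intro powr_mono2) auto
    also have "\<dots> = 2 powr (D + \<alpha> + \<epsilon>) * 2 powr (- ((\<alpha> + \<epsilon>) * real (Suc j) + D))"
      unfolding powr_powr powr_add[symmetric] by (simp add: algebra_simps)
    also have "\<dots> \<le> 2 powr (D + \<alpha> + \<epsilon>) * 2 powr (- real (cnt Br (Suc j)))"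
      using upper[of "Suc j"] by (intro mult_left_mono powr_mono) auto
    also have "\<dots> \<le> 2 powr (D + \<alpha> + \<epsilon>) * measure \<mu> (ball x r)"
      unfolding pw by (intro mult_left_mono measure_ball_ge[OF x r2]) auto
    finally have 1: "r powr (\<alpha> + \<epsilon>) \<le> 2 powr (D + \<alpha> + \<epsilon>) * measure \<mu> (ball x r)" .
    have "measure \<mu> (ball x r) \<le> 3 * 2 powr (- real (cnt Br j))"
      using measure_ball_le[OF r1, of x] unfolding pw by simp
    also have "\<dots> \<le> 3 * 2 powr (C - \<alpha> * real j)"
      using lower[of j] by (intro mult_left_mono powr_mono) auto
    also have "\<dots> = 3 * 2 powr (C + \<alpha>) * (2 powr (- real (Suc j))) powr \<alpha>"
      unfolding powr_powr mult.assoc powr_add[symmetric] by (simp add: algebra_simps)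
    also have "\<dots> \<le> 3 * 2 powr (C + \<alpha>) * r powr \<alpha>"
      using r2 \<alpha> unfolding pw by (intro mult_left_mono powr_mono2) auto
    finally show ?thesis using 1 by blast
  qed
  thus ?thesis unfolding ball_condition_def
    by (intro exI[of _ "2 powr (D + \<alpha> + \<epsilon>)"] exI[of _ "3 * 2 powr (C + \<alpha>)"] conjI) auto
qed

end

section \<open>Resonance and the multilinear quotient\<close>

text \<open>The exponential gain from the surplus of kept intervals beats the square root lost in
  the choice of signs.\<close>

lemma Suc_floor_sqrt_le: "real (Suc (floor_sqrt j)) * 2 powr (- real (floor_sqrt j) / 2) \<le> 2"
proof -
  define n where "n = floor_sqrt j"
  have "n div 2 < 2 ^ (n div 2)" by (rule less_exp)
  hence "Suc n \<le> 2 * 2 ^ (n div 2)" by linarith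
  hence "real (Suc n) \<le> real (2 * 2 ^ (n div 2))" by (simp only: of_nat_le_iff)
  hence "real (Suc n) \<le> 2 * 2 powr real (n div 2)" by (simp add: powr_realpow)
  also have "\<dots> \<le> 2 * 2 powr (real n / 2)" by (intro mult_left_mono powr_mono) auto
  finally have "real (Suc n) * 2 powr (- real n / 2) \<le> 2 * 2 powr (real n / 2) * 2 powr (- real n / 2)"
    by (intro mult_right_mono) auto
  also have "\<dots> = 2" by (simp add: mult.assoc flip: powr_add)
  finally show ?thesis unfolding n_def .
qed

text \<open>The set \<open>G I\<close> is the union of the depth \<open>I\<^sup>2\<close> intervals
  over the structured subtree; its indicator will be the test function.\<close>

lemma exists_cantor_measure:
  fixes \<alpha> \<beta> :: real
  assumes \<beta>: "0 < \<beta>" "\<beta> \<le> \<alpha>" and \<alpha>: "\<alpha> < 1"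
  obtains M :: "real measure" and E :: "real set" and G :: "nat \<Rightarrow> real set" where
    "finite_borel_measure M" "emeasure M UNIV \<noteq> 0" "compact E" "supported_on M E" "fourier_decay \<beta> M"
    "\<And>\<epsilon>. 0 < \<epsilon> \<Longrightarrow> ball_condition \<alpha> \<epsilon> (1 / 8) M E"
    "\<And>I. G I \<in> sets borel"
    "\<And>I. 2 powr (- (\<beta> / 2) * (real I)\<^sup>2 - 5 * real I) \<le> measure M (G I)"
    "\<And>I x. x \<in> G I \<Longrightarrow> \<exists>y \<in> pattern (levels (free_len (\<alpha> - \<beta> / 2))) (I\<^sup>2).
        real y / 2 ^ (I\<^sup>2) \<le> x \<and> x \<le> (real y + 1) / 2 ^ (I\<^sup>2)"
proof -
  define \<gamma> where "\<gamma> = \<alpha> - \<beta> / 2"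
  have \<gamma>: "0 \<le> \<gamma>" "\<gamma> \<le> \<alpha>" "\<gamma> \<le> 1" using assms by (auto simp: \<gamma>_def)
  define Br where "Br = levels (branch_len \<alpha>)"
  define S where "S = levels (free_len \<gamma>)"
  have sub: "S \<subseteq> Br" unfolding S_def Br_def
    using free_len_le_branch_len \<gamma> \<alpha> by (intro levels_mono) auto
  obtain pos where pos:
    "\<And>b. pos 0 b = 0"
    "\<And>j b. j \<in> Br \<Longrightarrow> pos (Suc j) b = 2 * pos j (b div 2) + b mod 2"
    "\<And>j. j \<notin> Br \<Longrightarrow> \<exists>\<sigma>. (\<forall>a. \<sigma> a \<in> {-1, 1::real}) \<and>
       (\<forall>b. pos (Suc j) b = 2 * pos j b + (if pos j b \<in> pattern S j \<or> \<sigma> (pos j b) = -1 then 0 else 1)) \<and>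
       (\<forall>\<theta>. norm (\<Sum>a\<in>pos j ` {..<2 ^ cnt Br j} - pattern S j. of_real (\<sigma> a) * cis (2 * pi * \<theta> * real a))
          \<le> 16 * sqrt (real (Suc j) * 2 ^ cnt Br j))"
    using exists_signed_tree[of Br S] by blast
  interpret T: cantor_tree Br S pos
    by (unfold_locales; fact sub pos)
  obtain C where C: "\<And>j. \<alpha> * real j + real (floor_sqrt j) - C \<le> real (cnt Br j)"
    using cnt_branch_ge[of \<alpha>] assms unfolding Br_def by auto
  have S_le: "real (cnt S j) \<le> \<gamma> * real j" for j
    unfolding S_def by (rule cnt_free_le) (use \<gamma> in auto)
  have pw: "2 ^ n = 2 powr real n" for n by (simp add: powr_realpow)
  have decay: "(2 ^ cnt S j + 16 * sqrt (real (Suc j) * 2 ^ cnt Br j)) / 2 ^ cnt Br j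
      \<le> (2 powr C + 32 * 2 powr (C / 2)) * 2 powr (- (\<beta> / 2) * real j)" for j
  proof -
    \<comment> \<open>The share of the subtree: \<open>\<gamma> - \<alpha> = - \<beta> / 2\<close>
      is exactly the exponent allowed.\<close>
    have "2 ^ cnt S j / 2 ^ cnt Br j = 2 powr (real (cnt S j) - real (cnt Br j))"
      unfolding pw powr_diff ..
    also have "\<dots> \<le> 2 powr (C + - (\<beta> / 2) * real j)"
    proof (intro powr_mono)
      have "real (cnt S j) - real (cnt Br j) \<le> \<gamma> * real j - (\<alpha> * real j + real (floor_sqrt j) - C)"
        using C[of j] S_le[of j] by linarith
      also have "\<dots> \<le> C + - (\<beta> / 2) * real j" by (simp add: \<gamma>_def algebra_simps)
      finally show "real (cnt S j) - real (cnt Br j) \<le> C + - (\<beta> / 2) * real j" .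
    qed simp
    finally have 1: "2 ^ cnt S j / 2 ^ cnt Br j \<le> 2 powr C * 2 powr (- (\<beta> / 2) * real j)"
      unfolding powr_add .
    \<comment> \<open>For the random part the square root of the count gives exponent
      \<open>- \<alpha> / 2\<close>, acceptable as \<open>\<beta> \<le> \<alpha>\<close>, and half
      of the surplus \<open>floor_sqrt j\<close>, which pays for
      \<open>sqrt (Suc j)\<close>.\<close>
    have "Suc j \<le> (Suc (floor_sqrt j))\<^sup>2" using Suc_floor_sqrt_power2_gt[of j] by simp
    hence "real (Suc j) \<le> (real (Suc (floor_sqrt j)))\<^sup>2" by (metis of_nat_le_iff of_nat_power)
    hence sq: "sqrt (real (Suc j)) \<le> real (Suc (floor_sqrt j))" by (rule real_le_lsqrt[rotated]) simp
    have "sqrt (2 ^ cnt Br j) / 2 ^ cnt Br j = 2 powr (- (real (cnt Br j) / 2))"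
      unfolding pw by (simp add: powr_half_sqrt[symmetric] powr_powr powr_diff[symmetric])
    also have "\<dots> \<le> 2 powr (C / 2 + - real (floor_sqrt j) / 2 + - (\<beta> / 2) * real j)"
    proof (intro powr_mono)
      have "\<beta> * real j \<le> \<alpha> * real j" using \<beta> by (intro mult_right_mono) auto
      thus "- (real (cnt Br j) / 2) \<le> C / 2 + - real (floor_sqrt j) / 2 + - (\<beta> / 2) * real j"
        using C[of j] by (simp add: field_simps)
    qed simp
    finally have "sqrt (real (Suc j)) * (sqrt (2 ^ cnt Br j) / 2 ^ cnt Br j) \<le>
        real (Suc (floor_sqrt j)) * 2 powr (C / 2 + - real (floor_sqrt j) / 2 + - (\<beta> / 2) * real j)"
      using sq by (intro mult_mono) auto
    also have "\<dots> = (real (Suc (floor_sqrt j)) * 2 powr (- real (floor_sqrt j) / 2)) *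
        (2 powr (C / 2) * 2 powr (- (\<beta> / 2) * real j))"
      unfolding powr_add by (simp only: mult_ac)
    also have "\<dots> \<le> 2 * (2 powr (C / 2) * 2 powr (- (\<beta> / 2) * real j))"
      by (intro mult_right_mono Suc_floor_sqrt_le) auto
    finally have 2: "sqrt (real (Suc j)) * (sqrt (2 ^ cnt Br j) / 2 ^ cnt Br j) \<le>
        2 * (2 powr (C / 2) * 2 powr (- (\<beta> / 2) * real j))" .
    have "(2 ^ cnt S j + 16 * sqrt (real (Suc j) * 2 ^ cnt Br j)) / 2 ^ cnt Br j =
        2 ^ cnt S j / 2 ^ cnt Br j + 16 * (sqrt (real (Suc j)) * (sqrt (2 ^ cnt Br j) / 2 ^ cnt Br j))"
      by (simp only: real_sqrt_mult add_divide_distrib times_divide_eq_right mult.assoc)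
    also have "\<dots> \<le> 2 powr C * 2 powr (- (\<beta> / 2) * real j) + 16 * (2 * (2 powr (C / 2) * 2 powr (- (\<beta> / 2) * real j)))"
      by (intro add_mono mult_left_mono 1 2) auto
    also have "\<dots> = (2 powr C + 32 * 2 powr (C / 2)) * 2 powr (- (\<beta> / 2) * real j)"
      by (simp add: distrib_right)
    finally show ?thesis .
  qed
  have ball: "ball_condition \<alpha> \<epsilon> (1 / 8) T.\<mu> T.E" if \<epsilon>: "0 < \<epsilon>" for \<epsilon>
  proof (rule T.ball_condition_\<mu>[OF _ \<epsilon>, where C = C and D = "5 + 9 / \<epsilon>"])
    fix j
    show "\<alpha> * real j - C \<le> real (cnt Br j)" using C[of j] by (smt (verit) of_nat_0_le_iff)
    define f where "f = real (floor_sqrt j)"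
    have "(floor_sqrt j)\<^sup>2 \<le> j" by simp
    hence "f\<^sup>2 \<le> real j" unfolding f_def by (metis of_nat_le_iff of_nat_power)
    hence "\<epsilon> * f\<^sup>2 \<le> \<epsilon> * real j" using \<epsilon> by (intro mult_left_mono) auto
    \<comment> \<open>Completing the square trades the excess \<open>6 * f\<close> for
      \<open>\<epsilon> * f\<^sup>2\<close>, at most \<open>\<epsilon> * j\<close>, at the price of
      the constant \<open>9 / \<epsilon>\<close>.\<close>
    moreover have "0 \<le> (\<epsilon> * f - 3)\<^sup>2 / \<epsilon>" using \<epsilon> by simp
    hence "6 * f \<le> \<epsilon> * f\<^sup>2 + 9 / \<epsilon>"
      using \<epsilon> by (simp add: power2_eq_square field_simps)
    moreover have "real (cnt Br j) \<le> \<alpha> * real j + 6 * f + 5"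
      using cnt_branch_le[of \<alpha> j] assms unfolding Br_def f_def by auto
    ultimately show "real (cnt Br j) \<le> (\<alpha> + \<epsilon>) * real j + (5 + 9 / \<epsilon>)"
      by (simp add: distrib_right)
  qed (use assms in auto)
  define Q where "Q I = {b \<in> {..<2 ^ cnt Br (I\<^sup>2)}. pos (I\<^sup>2) b \<in> pattern S (I\<^sup>2)}" for I
  define G where "G I = (\<Union>b\<in>Q I. T.ival (I\<^sup>2) b)" for I
  show ?thesis
  proof (rule that[of T.\<mu> T.E G])
    show "finite_borel_measure T.\<mu>"
      by (simp add: finite_borel_measure_def T.finite_measure_\<mu>)
    have "{u \<in> {0..<1}. T.cantor_pt u \<in> UNIV} = {0..<1}" by auto
    hence "measure T.\<mu> UNIV = 1" using T.measure_\<mu>[of UNIV] T.measure_U_space by (simp only: sets.top space_borel[symmetric])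
    thus "emeasure T.\<mu> UNIV \<noteq> 0"
      by (simp add: finite_measure.emeasure_eq_measure[OF T.finite_measure_\<mu>])
    show "compact T.E" by (rule T.compact_E)
    show "supported_on T.\<mu> T.E" by (rule T.supported_on_\<mu>)
    show "fourier_decay \<beta> T.\<mu>"
      by (rule T.fourier_decay_\<mu>[OF \<beta>(1) _ decay]) (use assms in simp)
    show "ball_condition \<alpha> \<epsilon> (1 / 8) T.\<mu> T.E" if "0 < \<epsilon>" for \<epsilon> using ball[OF that] .
    have finQ: "finite (Q I)" for I by (simp add: Q_def)
    show "G I \<in> sets borel" for I
      unfolding G_def T.ival_def using finQ by (intro borel_closed closed_UN) auto
    show "2 powr (- (\<beta> / 2) * (real I)\<^sup>2 - 5 * real I) \<le> measure T.\<mu> (G I)" for I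
    proof -
      have "pos (I\<^sup>2) ` Q I = pattern S (I\<^sup>2)"
        using T.pattern_subset_pos[of "I\<^sup>2"] by (auto simp: Q_def)
      moreover have "inj_on (pos (I\<^sup>2)) (Q I)"
        using T.inj_pos[of "I\<^sup>2"] by (rule inj_on_subset) (auto simp: Q_def)
      ultimately have card: "card (Q I) = 2 ^ cnt S (I\<^sup>2)"
        by (metis card_image card_pattern)
      \<comment> \<open>The 5 is composed of 1 per block for rounding the free digits down and 4 per
        block for the extra branching.\<close>
      have "2 powr (- (\<beta> / 2) * (real I)\<^sup>2 - 5 * real I) \<le> 2 powr (real (cnt S (I\<^sup>2)) - real (cnt Br (I\<^sup>2)))"
      proof (intro powr_mono)
        have "\<gamma> * (real I)\<^sup>2 - real I \<le> real (cnt S (I\<^sup>2))"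
          unfolding S_def by (rule cnt_free_square_ge) (use \<gamma> in auto)
        moreover have "real (cnt Br (I\<^sup>2)) \<le> \<alpha> * (real I)\<^sup>2 + 4 * real I"
          unfolding Br_def by (rule cnt_branch_square_le) (use assms in auto)
        moreover have "\<gamma> * (real I)\<^sup>2 = \<alpha> * (real I)\<^sup>2 - (\<beta> / 2) * (real I)\<^sup>2"
          by (simp add: \<gamma>_def left_diff_distrib)
        ultimately show "- (\<beta> / 2) * (real I)\<^sup>2 - 5 * real I \<le> real (cnt S (I\<^sup>2)) - real (cnt Br (I\<^sup>2))"
          by linarith
      qed simp
      also have "\<dots> = real (card (Q I)) / 2 ^ cnt Br (I\<^sup>2)"
        unfolding card of_nat_power of_nat_numeral pw powr_diff ..
      also have "\<dots> \<le> measure T.\<mu> (G I)"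
        unfolding G_def by (rule T.measure_ivals_ge) (auto simp: Q_def)
      finally show ?thesis .
    qed
    show "\<exists>y \<in> pattern (levels (free_len (\<alpha> - \<beta> / 2))) (I\<^sup>2).
        real y / 2 ^ (I\<^sup>2) \<le> x \<and> x \<le> (real y + 1) / 2 ^ (I\<^sup>2)" if x: "x \<in> G I" for I x
    proof -
      obtain b where b: "b \<in> Q I" "x \<in> T.ival (I\<^sup>2) b" using x unfolding G_def by blast
      have "pos (I\<^sup>2) b \<in> pattern (levels (free_len (\<alpha> - \<beta> / 2))) (I\<^sup>2)"
        using b(1) by (simp add: Q_def S_def \<gamma>_def)
      moreover have "real (pos (I\<^sup>2) b) / 2 ^ (I\<^sup>2) \<le> x \<and> x \<le> (real (pos (I\<^sup>2) b) + 1) / 2 ^ (I\<^sup>2)"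
        using b(2) by (simp add: T.ival_def)
      ultimately show ?thesis by blast
    qed
  qed
qed

lemma pattern_less: "y \<in> pattern S j \<Longrightarrow> y < 2 ^ j"
proof (induction j arbitrary: y)
  case (Suc j)
  have "y \<in> (\<lambda>y. 2 * y) ` pattern S j \<union> (if j \<in> S then (\<lambda>y. 2 * y + 1) ` pattern S j else {})"
    using Suc.prems by simp
  hence "y div 2 \<in> pattern S j" by (auto split: if_splits)
  thus ?case using Suc.IH[of "y div 2"] by simp
qed simp

text \<open>Three errors of at most \<open>1 / 32\<close> each fit into \<open>1 / 8\<close>: the
  resonance error, moving from the left endpoint to \<open>x\<close>, and moving from
  \<open>n\<close> to \<xi>. Dropping the blocks below \<open>i0\<close> from the frequencies leaves
  only the tail of a convergent series in the first one.\<close>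

lemma near_integer_eventually:
  fixes \<gamma> \<gamma>' :: real
  assumes \<gamma>: "0 \<le> \<gamma>" "\<gamma> < \<gamma>'" "\<gamma>' \<le> 1"
  obtains i0 where
    "\<And>I n y x \<xi>. I \<ge> i0 \<Longrightarrow> I \<ge> 2 \<Longrightarrow> n \<in> freqs i0 (free_len (1 - \<gamma>')) I \<Longrightarrow>
      y \<in> pattern (levels (free_len \<gamma>)) ((Suc I)\<^sup>2) \<Longrightarrow>
      real y / 2 ^ ((Suc I)\<^sup>2) \<le> x \<Longrightarrow> x \<le> (real y + 1) / 2 ^ ((Suc I)\<^sup>2) \<Longrightarrow>
      real n \<le> \<xi> \<Longrightarrow> \<xi> \<le> real n + 1 / 32 \<Longrightarrow> \<exists>z::nat. \<bar>x * \<xi> - real z\<bar> \<le> 1 / 8"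
proof -
  define \<rho> where "\<rho> = 2 powr (\<gamma> - \<gamma>')"
  have \<rho>: "0 < \<rho>" "\<rho> < 1" using \<gamma> by (auto simp: \<rho>_def powr_less_one)
  have "\<rho>\<^sup>2 < 1" using \<rho> by (simp add: power_less_one_iff)
  hence "summable (\<lambda>l. 2 * \<rho> * (\<rho>\<^sup>2) ^ l)" using \<rho> by (intro summable_mult summable_geometric) simp
  moreover have "2 * \<rho> ^ (2 * l + 1) = 2 * \<rho> * (\<rho>\<^sup>2) ^ l" for l
    by (simp add: power_mult[symmetric])
  ultimately have "summable (\<lambda>l. 2 * \<rho> ^ (2 * l + 1))" by (simp only:)
  then obtain i0 where i0: "\<And>m n. m \<ge> i0 \<Longrightarrow> norm (\<Sum>l=m..n. 2 * \<rho> ^ (2 * l + 1)) < 1 / 32"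
    by (rule summable_partial_sum_bound[of _ "1 / 32"]) auto
  show ?thesis
  proof (rule that[of i0])
    fix I n y x \<xi>
    assume I: "I \<ge> i0" "I \<ge> (2::nat)" and n: "n \<in> freqs i0 (free_len (1 - \<gamma>')) I"
      and y: "y \<in> pattern (levels (free_len \<gamma>)) ((Suc I)\<^sup>2)"
      and x: "real y / 2 ^ ((Suc I)\<^sup>2) \<le> x" "x \<le> (real y + 1) / 2 ^ ((Suc I)\<^sup>2)"
      and \<xi>: "real n \<le> \<xi>" "\<xi> \<le> real n + 1 / 32"
    define N where "N = (2::real) ^ ((Suc I)\<^sup>2)"
    have N: "N > 0" by (simp add: N_def)
    note x = x[folded N_def]
    have d: "free_len (1 - \<gamma>') i \<le> 2 * i + 1" for i by (rule free_len_le) (use \<gamma> in auto)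
    \<comment> \<open>Padding with a zero block lets the point lie one block deeper than the
      frequency. Since \<open>n < 2 ^ (I\<^sup>2)\<close>, the length of the interval then
      contributes at most \<open>1 / 2 ^ (2 * I + 1)\<close>, and \<open>I \<ge> 2\<close> brings
      this to \<open>1 / 32\<close>.\<close>
    have "n \<in> freqs i0 (free_len (1 - \<gamma>')) (Suc I)"
      using n I(1) by (auto intro!: rev_image_eqI[of "(n, 0)"])
    then obtain z :: nat where "\<bar>real n * real y / 2 ^ ((Suc I)\<^sup>2) - real z\<bar> \<le> (\<Sum>l\<in>{i0..<Suc I}. 2 * \<rho> ^ (2 * l + 1))"
      using near_integer[OF \<gamma> _ y] unfolding \<rho>_def by blast
    also have "\<dots> = (\<Sum>l=i0..I. 2 * \<rho> ^ (2 * l + 1))" by (simp only: atLeastLessThanSuc_atLeastAtMost)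
    also have "\<dots> \<le> 1 / 32" using i0[of i0 I] by (simp only: real_norm_def) linarith
    finally have z: "\<bar>real n * (real y / N) - real z\<bar> \<le> 1 / 32" by (simp add: N_def)
    have "real n \<le> real ((2::nat) ^ (I\<^sup>2))" using freqs_less[OF d n] by (intro of_nat_mono) simp
    hence nle: "real n \<le> 2 ^ (I\<^sup>2)" by simp
    have t: "0 \<le> x - real y / N" "x - real y / N \<le> 1 / N" using x by (simp_all add: add_divide_distrib)
    have "real n * (x - real y / N) \<le> 2 ^ (I\<^sup>2) * (1 / N)"
      using nle t by (intro mult_mono) auto
    also have "\<dots> = 1 / 2 ^ (2 * I + 1)"
    proof -
      have "(Suc I)\<^sup>2 = I\<^sup>2 + (2 * I + 1)" by (simp add: power2_eq_square)
      thus ?thesis unfolding N_def by (simp only: power_add) simp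
    qed
    also have "\<dots> \<le> 1 / 2 ^ 5"
      using I(2) by (intro divide_left_mono power_increasing) auto
    finally have e2: "real n * (x - real y / N) \<le> 1 / 32" by simp
    have e2': "0 \<le> real n * (x - real y / N)" using t by simp
    have "real (y + 1) \<le> real ((2::nat) ^ ((Suc I)\<^sup>2))" using pattern_less[OF y] by (intro of_nat_mono) simp
    hence "(real y + 1) / N \<le> 1" unfolding N_def by (simp add: add.commute)
    moreover have "0 \<le> real y / N" using N by simp
    ultimately have x1: "0 \<le> x" "x \<le> 1" using x by linarith+
    have e3: "0 \<le> (\<xi> - real n) * x" "(\<xi> - real n) * x \<le> 1 / 32 * 1"
      by (rule mult_nonneg_nonneg mult_mono; use x1 \<xi> in simp)+
    have "x * \<xi> - real z = (real n * (real y / N) - real z) + real n * (x - real y / N) + (\<xi> - real n) * x"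
      by (simp add: algebra_simps)
    hence "\<bar>x * \<xi> - real z\<bar> \<le> 1 / 8" using z e2 e2' e3 by linarith
    thus "\<exists>z::nat. \<bar>x * \<xi> - real z\<bar> \<le> 1 / 8" by blast
  qed
qed

section \<open>Lower bounds for the two norms and the number of frequencies\<close>

lemma cos_near_multiple_2pi:
  assumes "\<bar>t - real z\<bar> \<le> 1 / 8"
  shows "1 / 2 \<le> cos (2 * pi * t)"
proof -
  have "cos (2 * pi * t) = cos (2 * pi * (t - real z) + 2 * pi * of_int (int z))"
    by (simp add: algebra_simps)
  also have "\<dots> = cos (2 * pi * (t - real z))"
    using cos_int_2pin[of "int z"] sin_int_2pin[of "int z"] unfolding cos_add by simp
  also have "\<dots> = cos \<bar>2 * pi * (t - real z)\<bar>" by simp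
  also have "\<dots> \<ge> cos (pi / 3)"
  proof (rule cos_monotone_0_pi_le)
    have "\<bar>2 * pi * (t - real z)\<bar> = 2 * pi * \<bar>t - real z\<bar>" by (simp add: abs_mult)
    also have "\<dots> \<le> 2 * pi * (1 / 8)" using assms by (intro mult_left_mono) auto
    finally show "\<bar>2 * pi * (t - real z)\<bar> \<le> pi / 3" using pi_gt_zero by linarith
  qed auto
  finally show ?thesis by (simp add: cos_60)
qed

text \<open>All phases on \<open>G\<close> lie within an eighth of a turn of 1, so the real parts
  add up without cancellation.\<close>

lemma fourier_indicator_ge:
  assumes M: "finite_borel_measure M" and G: "G \<in> sets borel"
    and near: "\<And>x. x \<in> G \<Longrightarrow> \<exists>z::nat. \<bar>x * \<xi> - real z\<bar> \<le> 1 / 8"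
  shows "measure M G / 2 \<le> norm (fourier_measure M (indicator G) \<xi>)"
proof -
  interpret finite_measure M using M by (simp add: finite_borel_measure_def)
  have [measurable_cong, simp]: "sets M = sets borel" using M by (simp add: finite_borel_measure_def)
  have [measurable]: "G \<in> sets borel" by (rule G)
  have sp: "G \<inter> space M = G" using sets.sets_into_space[of G M] G by auto
  let ?f = "\<lambda>x. indicator G x * exp (- 2 * of_real pi * \<i> * of_real x * of_real \<xi>) :: complex"
  have int: "integrable M ?f"
    by (rule integrable_const_bound[where B = 1]) (auto simp: norm_mult indicator_def)
  have "measure M G / 2 = (LINT x|M. indicator G x * (1 / 2))"
    using sp by simp
  also have "\<dots> \<le> (LINT x|M. Re (?f x))"
  proof (rule integral_mono)
    show "integrable M (\<lambda>x. indicator G x * (1 / 2) :: real)"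
      by (rule integrable_const_bound[where B = 1]) (auto simp: indicator_def)
    show "integrable M (\<lambda>x. Re (?f x))" using int by (rule integrable_Re)
    fix x
    have "exp (- 2 * of_real pi * \<i> * of_real x * of_real \<xi>) = cis (- (2 * pi * (x * \<xi>)))"
      unfolding cis_conv_exp by (intro arg_cong[where f = exp]) simp
    hence "Re (exp (- 2 * of_real pi * \<i> * of_real x * of_real \<xi>)) = cos (2 * pi * (x * \<xi>))" by simp
    thus "indicator G x * (1 / 2) \<le> Re (?f x)"
      using near[of x] cos_near_multiple_2pi[of "x * \<xi>"] by (auto simp: indicator_def)
  qed
  also have "\<dots> = Re (fourier_measure M (indicator G) \<xi>)"
    unfolding fourier_measure_def using int by (rule integral_Re)
  also have "\<dots> \<le> norm (fourier_measure M (indicator G) \<xi>)" by (rule complex_Re_le_cmod)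
  finally show ?thesis .
qed

lemma Lp_norm_indicator:
  assumes M: "finite_measure M" and G: "G \<in> sets M" and p: "0 < p"
  shows "Lp_norm p M (indicator G) = ennreal (measure M G powr (1 / p))"
proof -
  interpret finite_measure M by (rule M)
  have "(\<integral>\<^sup>+ x. ennreal (norm (indicator G x :: complex) powr p) \<partial>M) = (\<integral>\<^sup>+ x. indicator G x \<partial>M)"
    by (intro nn_integral_cong) (auto simp: indicator_def)
  also have "\<dots> = ennreal (measure M G)" using G by (simp add: emeasure_eq_measure)
  finally show ?thesis by (simp add: Lp_norm_def Let_def)
qed

text \<open>Chebyshev's inequality. An infinite integral is treated separately because of the
  convention in \<open>Lp_norm\<close>.\<close>

lemma Lp_norm_ge:
  assumes F: "F \<in> sets M" "emeasure M F = ennreal v" and v: "0 \<le> v" and c: "0 \<le> c" and q: "0 < q"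
    and ge: "\<And>x. x \<in> F \<Longrightarrow> c \<le> norm (g x)"
  shows "ennreal (c * v powr (1 / q)) \<le> Lp_norm q M g"
proof -
  define I where "I = (\<integral>\<^sup>+ x. ennreal (norm (g x) powr q) \<partial>M)"
  have "ennreal (c powr q * v) = (\<integral>\<^sup>+ x. ennreal (c powr q) * indicator F x \<partial>M)"
    using F v by (simp add: nn_integral_cmult_indicator ennreal_mult)
  also have "\<dots> \<le> I" unfolding I_def
    using ge c q by (intro nn_integral_mono) (auto simp: indicator_def intro!: ennreal_leI powr_mono2)
  finally have le: "ennreal (c powr q * v) \<le> I" .
  show ?thesis
  proof (cases "I = top")
    case True
    thus ?thesis by (simp add: Lp_norm_def I_def[symmetric])
  next
    case False
    hence "I = ennreal (enn2real I)" by (simp add: less_top)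
    hence "ennreal (c powr q * v) \<le> ennreal (enn2real I)" using le by simp
    hence "c powr q * v \<le> enn2real I" by (subst (asm) ennreal_le_iff) auto
    hence "(c powr q * v) powr (1 / q) \<le> enn2real I powr (1 / q)"
      using v q by (intro powr_mono2) auto
    moreover have "(c powr q * v) powr (1 / q) = c * v powr (1 / q)"
      using c v q by (simp add: powr_mult powr_powr)
    ultimately show ?thesis
      using False by (simp add: Lp_norm_def I_def[symmetric] ennreal_leI)
  qed
qed

lemma emeasure_intervals_at_naturals:
  assumes "finite D"
  shows "emeasure lborel (\<Union>n\<in>D. {real n .. real n + 1 / 32}) = ennreal (real (card D) / 32)"
proof -
  have "disjoint_family_on (\<lambda>n. {real n .. real n + 1 / 32}) D"
  proof (unfold disjoint_family_on_def, intro ballI impI)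
    fix m n :: nat assume "m \<noteq> n"
    hence "real m + 1 \<le> real n \<or> real n + 1 \<le> real m" by linarith
    thus "{real m .. real m + 1 / 32} \<inter> {real n .. real n + 1 / 32} = {}" by auto
  qed
  hence "emeasure lborel (\<Union>n\<in>D. {real n .. real n + 1 / 32}) = (\<Sum>n\<in>D. emeasure lborel {real n .. real n + 1 / 32})"
    using assms by (intro sum_emeasure[symmetric]) auto
  also have "\<dots> = (\<Sum>n\<in>D. ennreal (1 / 32))" by (intro sum.cong) auto
  also have "\<dots> = ennreal (\<Sum>n\<in>D. 1 / 32)" by (rule sum_ennreal) auto
  finally show ?thesis by simp
qed

text \<open>The block lengths telescope to a difference of squares, and rounding costs at most one
  digit for each block from \<open>i0\<close> on.\<close>

lemma card_freqs_ge:
  assumes "0 \<le> \<delta>" "\<delta> \<le> 1" "i0 \<le> I"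
  shows "2 powr (\<delta> * ((real I)\<^sup>2 - (real i0)\<^sup>2) - real I) \<le> real (card (freqs i0 (free_len \<delta>) I))"
proof -
  have "\<delta> * ((real I)\<^sup>2 - (real i0)\<^sup>2) - (real I - real i0) \<le> (\<Sum>i\<in>{i0..<I}. real (free_len \<delta> i))"
    using assms(3)
  proof (induction I rule: dec_induct)
    case (step I)
    thus ?case using free_len_bounds(2)[OF assms(1), of I]
      by (simp add: power2_eq_square algebra_simps)
  qed simp
  hence "2 powr (\<delta> * ((real I)\<^sup>2 - (real i0)\<^sup>2) - real I) \<le> 2 powr real (\<Sum>i\<in>{i0..<I}. free_len \<delta> i)"
    by (intro powr_mono) auto
  also have "\<dots> = real (card (freqs i0 (free_len \<delta>) I))"
    using card_freqs[of "free_len \<delta>" i0 I] free_len_le[OF assms(1,2)] by (simp add: powr_realpow del: of_nat_sum)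
  finally show ?thesis .
qed

lemma quadratic_at_top:
  fixes h c d :: real
  assumes "0 < h"
  shows "filterlim (\<lambda>I. h * (real I)\<^sup>2 + c * real I + d) at_top sequentially"
proof -
  have lin: "filterlim (\<lambda>I. c + h * real I) at_top sequentially"
    by (rule filterlim_tendsto_add_at_top[OF tendsto_const
          filterlim_tendsto_pos_mult_at_top[OF tendsto_const assms filterlim_real_sequentially]])
  have "filterlim (\<lambda>I. d + real I * (c + h * real I)) at_top sequentially"
    by (rule filterlim_tendsto_add_at_top[OF tendsto_const
          filterlim_at_top_mult_at_top[OF filterlim_real_sequentially lin]])
  thus ?thesis by (simp add: power2_eq_square algebra_simps)
qed

lemma tendsto_top_ennreal_powr:
  fixes e :: "nat \<Rightarrow> real" and f :: "nat \<Rightarrow> ennreal"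
  assumes e: "filterlim e at_top sequentially" and f: "\<And>l. ennreal (2 powr e l) \<le> f l"
  shows "(f \<longlongrightarrow> top) sequentially"
  unfolding tendsto_top_iff_ennreal
proof (intro allI impI)
  fix l :: real assume l: "0 \<le> l"
  have "eventually (\<lambda>n. e n > log 2 (l + 1)) sequentially"
    using e by (simp add: filterlim_at_top_dense)
  thus "eventually (\<lambda>n. ennreal l < f n) sequentially"
  proof eventually_elim
    case (elim n)
    have "l < l + 1" by simp
    also have "l + 1 = 2 powr log 2 (l + 1)" using l by simp
    also have "\<dots> < 2 powr e n" using elim by (intro powr_less_mono) auto
    finally have "ennreal l < ennreal (2 powr e n)" using l by (intro ennreal_lessI) auto
    thus ?case using f[of n] by (rule order.strict_trans2)
  qed
qed

theorem theorem3p1: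
  fixes k :: nat and p q :: real and \<alpha> \<beta> :: "nat \<Rightarrow> real"
  assumes "k \<ge> 2" and "1 < p" and "1 \<le> q"
    and "\<And>m. m \<in> {1..k} \<Longrightarrow> 0 < \<beta> m \<and> \<beta> m \<le> \<alpha> m \<and> \<alpha> m < 1"
    and "\<And>j. 1 \<le> j \<Longrightarrow> j \<le> k - 1 \<Longrightarrow> \<alpha> (j + 1) - \<beta> (j + 1) / 2 \<le> \<alpha> j - \<beta> j / 2"
    and "(\<alpha> k - \<beta> k / 2) + (real k - 1) * (\<alpha> 1 - \<beta> 1 / 2) < 1"
  shows "\<exists>(\<mu> :: nat \<Rightarrow> real measure) (E :: nat \<Rightarrow> real set).
    (\<forall>m\<in>{1..k}. finite_borel_measure (\<mu> m) \<and> emeasure (\<mu> m) UNIV \<noteq> 0 \<and>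
       compact (E m) \<and> supported_on (\<mu> m) (E m) \<and> fourier_decay (\<beta> m) (\<mu> m)) \<and>
    (\<forall>\<epsilon>>0. \<exists>r\<^sub>0. 0 < r\<^sub>0 \<and> r\<^sub>0 < 1 / 4 \<and>
       (\<forall>m\<in>{1..k}. ball_condition (\<alpha> m) \<epsilon> r\<^sub>0 (\<mu> m) (E m))) \<and>
    (q < (2 * p * (1 - (\<Sum>m=1..k. \<alpha> m)) + p * (\<Sum>m=1..k. \<beta> m)) / ((p - 1) * (\<Sum>m=1..k. \<beta> m)) \<longrightarrow>
       (\<exists>f :: nat \<Rightarrow> nat \<Rightarrow> real \<Rightarrow> complex.
          (\<forall>l. \<forall>m\<in>{1..k}. f l m \<in> Lp_space p (\<mu> m) \<and> 0 < Lp_norm p (\<mu> m) (f l m)) \<and>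
          ((\<lambda>l. Lp_norm q lborel (\<lambda>\<xi>. \<Prod>m=1..k. fourier_measure (\<mu> m) (f l m) \<xi>)
                / (\<Prod>m=1..k. Lp_norm p (\<mu> m) (f l m))) \<longlongrightarrow> top) sequentially))"
proof -
  define \<gamma> where "\<gamma> m = \<alpha> m - \<beta> m / 2" for m
  have \<gamma>_pos: "0 < \<gamma> m" if "m \<in> {1..k}" for m
    using assms(4)[OF that] by (simp add: \<gamma>_def)
  have \<gamma>_le: "\<gamma> m \<le> \<gamma> 1" if "m \<in> {1..k}" for m
  proof -
    from that have "1 \<le> m" "m \<le> k" by auto
    thus ?thesis
    proof (induction m rule: dec_induct)
      case (step n)
      hence "\<gamma> (n + 1) \<le> \<gamma> n" using assms(5)[of n] by (simp add: \<gamma>_def)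
      thus ?case using step by simp
    qed simp
  qed
  \<comment> \<open>Bundling everything known about one measure lets measure, support and test sets
    be chosen together for each \<open>m\<close>.\<close>
  define P where "P m M E G \<longleftrightarrow>
    finite_borel_measure M \<and> emeasure M UNIV \<noteq> 0 \<and> compact E \<and> supported_on M E \<and> fourier_decay (\<beta> m) M \<and>
    (\<forall>\<epsilon>>0. ball_condition (\<alpha> m) \<epsilon> (1 / 8) M E) \<and>
    (\<forall>I. G I \<in> sets borel \<and> 2 powr (- (\<beta> m / 2) * (real I)\<^sup>2 - 5 * real I) \<le> measure M (G I) \<and>
      (\<forall>x\<in>G I. \<exists>y \<in> pattern (levels (free_len (\<gamma> m))) (I\<^sup>2).
        real y / 2 ^ (I\<^sup>2) \<le> x \<and> x \<le> (real y + 1) / 2 ^ (I\<^sup>2)))"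
    for m and M :: "real measure" and E :: "real set" and G :: "nat \<Rightarrow> real set"
  have "\<exists>M E G. P m M E G" if m: "m \<in> {1..k}" for m
  proof -
    have "0 < \<beta> m" "\<beta> m \<le> \<alpha> m" "\<alpha> m < 1" using assms(4)[OF m] by auto
    thus ?thesis
      by (rule exists_cantor_measure) (unfold P_def \<gamma>_def, blast)
  qed
  hence "\<forall>m\<in>{1..k}. \<exists>M E G. P m M E G" by blast
  then obtain \<mu> E G where P: "\<And>m. m \<in> {1..k} \<Longrightarrow> P m (\<mu> m) (E m) (G m)"
    by metis
  have fb: "finite_borel_measure (\<mu> m)" and fin: "finite_measure (\<mu> m)"
    and sets_\<mu>: "sets (\<mu> m) = sets borel" and G_borel: "G m I \<in> sets borel"
    and G_ge: "2 powr (- (\<beta> m / 2) * (real I)\<^sup>2 - 5 * real I) \<le> measure (\<mu> m) (G m I)"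
    and G_pattern: "\<And>x. x \<in> G m I \<Longrightarrow> \<exists>y \<in> pattern (levels (free_len (\<gamma> m))) (I\<^sup>2).
        real y / 2 ^ (I\<^sup>2) \<le> x \<and> x \<le> (real y + 1) / 2 ^ (I\<^sup>2)"
    if "m \<in> {1..k}" for m I
    using P[OF that] unfolding P_def finite_borel_measure_def by blast+
  have ex_f: "\<exists>f :: nat \<Rightarrow> nat \<Rightarrow> real \<Rightarrow> complex.
          (\<forall>l. \<forall>m\<in>{1..k}. f l m \<in> Lp_space p (\<mu> m) \<and> 0 < Lp_norm p (\<mu> m) (f l m)) \<and>
          ((\<lambda>l. Lp_norm q lborel (\<lambda>\<xi>. \<Prod>m=1..k. fourier_measure (\<mu> m) (f l m) \<xi>)
                / (\<Prod>m=1..k. Lp_norm p (\<mu> m) (f l m))) \<longlongrightarrow> top) sequentially"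
    if q: "q < (2 * p * (1 - (\<Sum>m=1..k. \<alpha> m)) + p * (\<Sum>m=1..k. \<beta> m)) / ((p - 1) * (\<Sum>m=1..k. \<beta> m))"
  proof -
    define B where "B = (\<Sum>m=1..k. \<beta> m)"
    define \<Gamma> where "\<Gamma> = (\<Sum>m=1..k. \<gamma> m)"
    have B: "0 < B" unfolding B_def using assms(1,4) by (intro sum_pos) auto
    have \<Gamma>_eq: "\<Gamma> = (\<Sum>m=1..k. \<alpha> m) - B / 2"
      by (simp add: \<Gamma>_def \<gamma>_def B_def sum_subtractf sum_divide_distrib)
    have "0 < (p - 1) * B" using B assms(2) by simp
    hence qB: "q * ((p - 1) * B) < 2 * p * (1 - \<Gamma>)"
      using q unfolding B_def[symmetric] \<Gamma>_eq by (simp add: pos_less_divide_eq algebra_simps)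
    \<comment> \<open>The exponential rate of the quotient per unit of \<open>I\<^sup>2\<close>; its
      positivity is the hypothesis on \<open>q\<close> rearranged.\<close>
    define h where "h = (1 - \<Gamma>) / q - (1 - 1 / p) * (B / 2)"
    have h: "0 < h"
    proof -
      have "(1 - 1 / p) * (B / 2) = q * ((p - 1) * B) / (2 * p * q)"
        using assms(2,3) by (simp add: field_simps)
      also have "\<dots> < 2 * p * (1 - \<Gamma>) / (2 * p * q)"
        using qB assms(2,3) by (intro divide_strict_right_mono) auto
      also have "\<dots> = (1 - \<Gamma>) / q" using assms(2,3) by simp
      finally show ?thesis by (simp add: h_def)
    qed
    have \<Gamma>1: "\<Gamma> \<le> 1"
    proof -
      have "0 \<le> q * ((p - 1) * B)" using assms(2,3) B by simp
      hence "0 < 2 * p * (1 - \<Gamma>)" using qB by linarith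
      thus ?thesis using assms(2) by (simp add: zero_less_mult_iff)
    qed
    \<comment> \<open>At least two measures are present, so the sum strictly exceeds its first term;
      this is the gap that the resonance lemma requires.\<close>
    have "\<gamma> 1 < \<Gamma>"
    proof -
      have "\<Gamma> = \<gamma> 1 + (\<Sum>m\<in>{2..k}. \<gamma> m)"
        unfolding \<Gamma>_def using assms(1) by (simp add: sum.atLeast_Suc_atMost numeral_2_eq_2)
      moreover have "0 < (\<Sum>m\<in>{2..k}. \<gamma> m)" using assms(1) \<gamma>_pos by (intro sum_pos) auto
      ultimately show ?thesis by simp
    qed
    moreover have "0 \<le> \<gamma> 1" using \<gamma>_pos[of 1] assms(1) by simp
    ultimately obtain i0 where near: "\<And>I n y x \<xi>. I \<ge> i0 \<Longrightarrow> I \<ge> 2 \<Longrightarrow> n \<in> freqs i0 (free_len (1 - \<Gamma>)) I \<Longrightarrow>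
      y \<in> pattern (levels (free_len (\<gamma> 1))) ((Suc I)\<^sup>2) \<Longrightarrow>
      real y / 2 ^ ((Suc I)\<^sup>2) \<le> x \<Longrightarrow> x \<le> (real y + 1) / 2 ^ ((Suc I)\<^sup>2) \<Longrightarrow>
      real n \<le> \<xi> \<Longrightarrow> \<xi> \<le> real n + 1 / 32 \<Longrightarrow> \<exists>z::nat. \<bar>x * \<xi> - real z\<bar> \<le> 1 / 8"
      using near_integer_eventually[of "\<gamma> 1" \<Gamma>] \<Gamma>1 by blast
    \<comment> \<open>The shift ensures \<open>L l \<ge> i0\<close> and \<open>L l \<ge> 2\<close>,
      so the resonance applies for every \<open>l\<close>. The test sets use one block more than the
      frequencies.\<close>
    define L where "L l = l + i0 + 2" for l
    define w where "w l m = measure (\<mu> m) (G m (Suc (L l)))" for l m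
    define f :: "nat \<Rightarrow> nat \<Rightarrow> real \<Rightarrow> complex" where "f l m = indicator (G m (Suc (L l)))" for l m
    have w_pos: "0 < w l m" if "m \<in> {1..k}" for l m
      using less_le_trans[OF _ G_ge[OF that]] unfolding w_def by simp
    have norm_f: "Lp_norm p (\<mu> m) (f l m) = ennreal (w l m powr (1 / p))" if "m \<in> {1..k}" for l m
      unfolding f_def w_def
      by (rule Lp_norm_indicator) (use that fin sets_\<mu> G_borel assms(2) in auto)
    have f_Lp: "f l m \<in> Lp_space p (\<mu> m) \<and> 0 < Lp_norm p (\<mu> m) (f l m)" if m: "m \<in> {1..k}" for l m
    proof -
      have "f l m \<in> borel_measurable (\<mu> m)"
        unfolding f_def using G_borel[OF m] sets_\<mu>[OF m] by (intro borel_measurable_indicator) simp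
      thus ?thesis using w_pos[OF m, of l] by (simp add: Lp_space_def norm_f[OF m])
    qed
    define D where "D l = freqs i0 (free_len (1 - \<Gamma>)) (L l)" for l
    define c where "c l = (\<Prod>m=1..k. w l m / 2)" for l
    have lower: "c l \<le> norm (\<Prod>m=1..k. fourier_measure (\<mu> m) (f l m) \<xi>)"
      if \<xi>: "\<xi> \<in> (\<Union>n\<in>D l. {real n .. real n + 1 / 32})" for l \<xi>
    proof -
      obtain n where n: "n \<in> D l" "real n \<le> \<xi>" "\<xi> \<le> real n + 1 / 32" using \<xi> by auto
      have "w l m / 2 \<le> norm (fourier_measure (\<mu> m) (f l m) \<xi>)" if m: "m \<in> {1..k}" for m
        unfolding w_def f_def
      proof (rule fourier_indicator_ge[OF fb[OF m] G_borel[OF m]])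
        fix x assume "x \<in> G m (Suc (L l))"
        then obtain y where y: "y \<in> pattern (levels (free_len (\<gamma> m))) ((Suc (L l))\<^sup>2)"
          "real y / 2 ^ ((Suc (L l))\<^sup>2) \<le> x" "x \<le> (real y + 1) / 2 ^ ((Suc (L l))\<^sup>2)"
          using G_pattern[OF m] by blast
        \<comment> \<open>Here the ordering of the \<open>\<gamma> m\<close> enters: frequencies
          tuned to the largest subtree resonate with all the others.\<close>
        have "y \<in> pattern (levels (free_len (\<gamma> 1))) ((Suc (L l))\<^sup>2)"
        proof (rule subsetD[OF pattern_mono[OF levels_mono] y(1)])
          show "free_len (\<gamma> m) i \<le> free_len (\<gamma> 1) i" for i by (rule free_len_mono[OF \<gamma>_le[OF m]])
        qed
        thus "\<exists>z::nat. \<bar>x * \<xi> - real z\<bar> \<le> 1 / 8"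
          using near[of "L l" n y x \<xi>] y n unfolding D_def L_def by auto
      qed
      hence "c l \<le> (\<Prod>m=1..k. norm (fourier_measure (\<mu> m) (f l m) \<xi>))"
        unfolding c_def using w_pos by (intro prod_mono) (auto intro: less_imp_le)
      thus ?thesis by (simp add: prod_norm)
    qed
    define v where "v l = real (card (D l)) / 32" for l
    have num: "ennreal (c l * v l powr (1 / q)) \<le> Lp_norm q lborel (\<lambda>\<xi>. \<Prod>m=1..k. fourier_measure (\<mu> m) (f l m) \<xi>)" for l
    proof (rule Lp_norm_ge[where F = "\<Union>n\<in>D l. {real n .. real n + 1 / 32}"])
      show "emeasure lborel (\<Union>n\<in>D l. {real n .. real n + 1 / 32}) = ennreal (v l)"
        unfolding v_def by (rule emeasure_intervals_at_naturals) (simp add: D_def)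
      show "(\<Union>n\<in>D l. {real n .. real n + 1 / 32}) \<in> sets lborel"
        by (auto simp: D_def intro!: sets.finite_UN)
      show "0 \<le> c l" unfolding c_def using w_pos by (intro prod_nonneg) (auto intro: less_imp_le)
    qed (use assms(3) lower in \<open>auto simp: v_def\<close>)
    have den: "(\<Prod>m=1..k. Lp_norm p (\<mu> m) (f l m)) = ennreal (\<Prod>m=1..k. w l m powr (1 / p))" for l
    proof -
      have "(\<Prod>m=1..k. Lp_norm p (\<mu> m) (f l m)) = (\<Prod>m=1..k. ennreal (w l m powr (1 / p)))"
        by (intro prod.cong refl norm_f)
      thus ?thesis by (simp add: prod_ennreal)
    qed
    have ratio: "ennreal (c l * v l powr (1 / q)) / ennreal (\<Prod>m=1..k. w l m powr (1 / p)) \<le>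
        Lp_norm q lborel (\<lambda>\<xi>. \<Prod>m=1..k. fourier_measure (\<mu> m) (f l m) \<xi>) / (\<Prod>m=1..k. Lp_norm p (\<mu> m) (f l m))" for l
      unfolding den by (rule divide_right_mono_ennreal[OF num])
    \<comment> \<open>Logarithms to base 2 of the lower bounds: the final 1 in \<open>e1\<close>
      stands for the factor one half in the Fourier bound, the 5 in \<open>e2\<close> for the
      interval length \<open>1 / 32\<close>.\<close>
    define e1 where "e1 I m = (1 - 1 / p) * (- (\<beta> m / 2) * (real (Suc I))\<^sup>2 - 5 * real (Suc I)) - 1" for I m
    define e2 where "e2 I = (1 / q) * ((1 - \<Gamma>) * ((real I)\<^sup>2 - (real i0)\<^sup>2) - real I - 5)" for I
    define e where "e l = (\<Sum>m=1..k. e1 (L l) m) + e2 (L l)" for l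
    have e_le: "2 powr e l \<le> c l * v l powr (1 / q) / (\<Prod>m=1..k. w l m powr (1 / p))" for l
    proof -
      have "2 powr e1 (L l) m \<le> w l m / 2 / w l m powr (1 / p)" if m: "m \<in> {1..k}" for m
      proof -
        have "2 powr e1 (L l) m = (2 powr (- (\<beta> m / 2) * (real (Suc (L l)))\<^sup>2 - 5 * real (Suc (L l)))) powr (1 - 1 / p) / 2"
          unfolding e1_def powr_powr by (simp add: powr_diff mult.commute)
        also have "\<dots> \<le> w l m powr (1 - 1 / p) / 2"
          unfolding w_def using G_ge[OF m, of "Suc (L l)"] assms(2)
          by (intro divide_right_mono powr_mono2) auto
        also have "\<dots> = w l m / 2 / w l m powr (1 / p)"
          using w_pos[OF m, of l] by (simp add: powr_diff mult.commute)
        finally show ?thesis .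
      qed
      hence "(\<Prod>m=1..k. 2 powr e1 (L l) m) \<le> (\<Prod>m=1..k. w l m / 2 / w l m powr (1 / p))"
        by (intro prod_mono) auto
      also have "\<dots> = c l / (\<Prod>m=1..k. w l m powr (1 / p))"
        by (simp only: c_def prod_dividef)
      finally have 1: "2 powr (\<Sum>m=1..k. e1 (L l) m) \<le> c l / (\<Prod>m=1..k. w l m powr (1 / p))"
        by (simp add: powr_sum)
      have "2 powr ((1 - \<Gamma>) * ((real (L l))\<^sup>2 - (real i0)\<^sup>2) - real (L l) - 5) =
          2 powr ((1 - \<Gamma>) * ((real (L l))\<^sup>2 - (real i0)\<^sup>2) - real (L l)) / 32"
        by (simp add: powr_diff)
      also have "\<dots> \<le> v l" unfolding v_def D_def
      proof (intro divide_right_mono card_freqs_ge)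
        show "1 - \<Gamma> \<le> 1" using \<open>\<gamma> 1 < \<Gamma>\<close> \<open>0 \<le> \<gamma> 1\<close> by simp
      qed (use \<Gamma>1 in \<open>auto simp: L_def\<close>)
      finally have "(2 powr ((1 - \<Gamma>) * ((real (L l))\<^sup>2 - (real i0)\<^sup>2) - real (L l) - 5)) powr (1 / q) \<le> v l powr (1 / q)"
        using assms(3) by (intro powr_mono2) auto
      hence 2: "2 powr e2 (L l) \<le> v l powr (1 / q)"
        unfolding e2_def powr_powr by (simp only: mult.commute)
      have "2 powr e l = 2 powr (\<Sum>m=1..k. e1 (L l) m) * 2 powr e2 (L l)"
        by (simp add: e_def powr_add)
      also have "\<dots> \<le> c l / (\<Prod>m=1..k. w l m powr (1 / p)) * v l powr (1 / q)"
        by (rule mult_mono[OF 1 2]) (auto simp: c_def intro!: divide_nonneg_nonneg prod_nonneg less_imp_le[OF w_pos])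
      finally show ?thesis by simp
    qed
    have "ennreal (2 powr e l) \<le> Lp_norm q lborel (\<lambda>\<xi>. \<Prod>m=1..k. fourier_measure (\<mu> m) (f l m) \<xi>) /
        (\<Prod>m=1..k. Lp_norm p (\<mu> m) (f l m))" for l
    proof -
      have "ennreal (2 powr e l) \<le> ennreal (c l * v l powr (1 / q) / (\<Prod>m=1..k. w l m powr (1 / p)))"
        by (rule ennreal_leI[OF e_le])
      also have "\<dots> = ennreal (c l * v l powr (1 / q)) / ennreal (\<Prod>m=1..k. w l m powr (1 / p))"
      proof (rule divide_ennreal[symmetric])
        show "0 \<le> c l * v l powr (1 / q)"
          unfolding c_def by (intro mult_nonneg_nonneg prod_nonneg) (auto intro: less_imp_le[OF w_pos])
        show "0 < (\<Prod>m=1..k. w l m powr (1 / p))"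
          using w_pos by (intro prod_pos) (auto simp: less_le)
      qed
      also note ratio
      finally show ?thesis .
    qed
    moreover have "filterlim e at_top sequentially"
    proof -
      define C where "C = (1 - 1 / p)"
      have e1_sum: "(\<Sum>m=1..k. e1 I m) = - (C * (B / 2)) * (real (Suc I))\<^sup>2 - 5 * real k * C * real (Suc I) - real k" for I
      proof -
        have "e1 I m = - (C * (real (Suc I))\<^sup>2 / 2) * \<beta> m - (5 * C * real (Suc I) + 1)" for m
          by (simp add: e1_def C_def[symmetric] algebra_simps)
        hence "(\<Sum>m=1..k. e1 I m) = - (C * (real (Suc I))\<^sup>2 / 2) * B - real k * (5 * C * real (Suc I) + 1)"
          by (simp add: sum_subtractf B_def sum_distrib_left sum_negf)
        thus ?thesis by (simp add: algebra_simps)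
      qed
      \<comment> \<open>Coefficients from expanding the square of \<open>Suc I\<close>; only the
        leading coefficient \<open>h\<close> decides the limit.\<close>
      define c1 where "c1 = - (C * B) - 5 * real k * C - 1 / q"
      define c0 where "c0 = - (C * (B / 2)) - 5 * real k * C - real k - (1 / q) * ((1 - \<Gamma>) * (real i0)\<^sup>2 + 5)"
      have "(\<Sum>m=1..k. e1 I m) + e2 I = h * (real I)\<^sup>2 + c1 * real I + c0" for I
      proof -
        have h_eq: "h = (1 / q) * (1 - \<Gamma>) - C * (B / 2)" by (simp add: h_def C_def)
        show ?thesis unfolding e1_sum e2_def c1_def c0_def h_eq
          by (simp add: power2_eq_square algebra_simps diff_divide_distrib add_divide_distrib)
      qed
      hence "filterlim (\<lambda>I. (\<Sum>m=1..k. e1 I m) + e2 I) at_top sequentially"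
        using quadratic_at_top[OF h, of c1 c0] by simp
      moreover have "filterlim L at_top sequentially"
        unfolding L_def by (rule filterlim_at_top_mono[OF filterlim_ident]) auto
      ultimately show ?thesis unfolding e_def by (rule filterlim_compose)
    qed
    ultimately have "((\<lambda>l. Lp_norm q lborel (\<lambda>\<xi>. \<Prod>m=1..k. fourier_measure (\<mu> m) (f l m) \<xi>)
                / (\<Prod>m=1..k. Lp_norm p (\<mu> m) (f l m))) \<longlongrightarrow> top) sequentially"
      by (intro tendsto_top_ennreal_powr)
    thus ?thesis using f_Lp by blast
  qed
  show ?thesis
  proof (intro exI[of _ \<mu>] exI[of _ E] conjI)
    show "\<forall>m\<in>{1..k}. finite_borel_measure (\<mu> m) \<and> emeasure (\<mu> m) UNIV \<noteq> 0 \<and>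
       compact (E m) \<and> supported_on (\<mu> m) (E m) \<and> fourier_decay (\<beta> m) (\<mu> m)"
      using P unfolding P_def by blast
    show "\<forall>\<epsilon>>0. \<exists>r\<^sub>0. 0 < r\<^sub>0 \<and> r\<^sub>0 < 1 / 4 \<and> (\<forall>m\<in>{1..k}. ball_condition (\<alpha> m) \<epsilon> r\<^sub>0 (\<mu> m) (E m))"
    proof (intro allI impI exI[of _ "1 / 8 :: real"] conjI ballI)
      fix \<epsilon> :: real and m assume "\<epsilon> > 0" "m \<in> {1..k}"
      thus "ball_condition (\<alpha> m) \<epsilon> (1 / 8) (\<mu> m) (E m)" using P unfolding P_def by blast
    qed auto
  qed (use ex_f in blast)
qed

end
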